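(* Let $d\ge 1$. Then $$\mathcal{P}_{d}(z,t)=\sum_{0\leq k <d/2} \psi_{d-2k} \left( \frac{(-1)^k t^{k(k+1)} (1-t^2)}{(t^2;t^2)_k\,(t^2;t^2)_{d-k}} \right) \frac{1}{1-z t^{d-2k}},$$ where the argument of $\psi_{d-2k}$ is expanded as a formal power series in $t$.
   Context: $V_d$ denotes the complex vector space of binary forms of degree $d$, with the natural action of $G=SL(2,\mathbb{C})$. The algebra of covariants is $\mathcal{C}_d=\mathbb{C}[V_d\oplus\mathbb{C}^2]^{G}$, bigraded so that $(\mathcal{C}_d)_{i,j}$ is the space of invariants homogeneous of degree $i$ in the coordinates of $V_d$ and of degree $j$ in the coordinates of $\mathbb{C}^2$. Its bivariate Poincaré series is $\mathcal{P}_d(z,t)=\sum_{i,j\ge 0}\dim((\mathcal{C}_d)_{i,j})\,z^it^j$. $(a;q)_n=(1-a)(1-aq)\cdots(1-aq^{n-1})$ is the $q$-shifted factorial, with $(a;q)_0=1$. For a positive integer $n$, $\psi_n:\mathbb{C}[[t]]\to\mathbb{C}[[z,t]]$ is the linear map (extended termwise to power series) defined by $\psi_n(t^m)=z^it^j$ where $i\ge 0$ and $0\le j<n$ are the unique integers with $m=ni-j$. *)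

theory Defs
  imports Complex_Main "HOL-Computational_Algebra.Formal_Power_Series" "HOL-Library.Function_Algebras"
begin

text \<open>Points of V_d (+) C^2: a coefficient vector a (only a 0..a d matter), and (x,y) in C^2.
  The binary form with coefficients a is  f(x,y) = sum_{k<=d} a_k x^(d-k) y^k.\<close>

type_synonym point = "(nat \<Rightarrow> complex) \<times> complex \<times> complex"

definition bform :: "nat \<Rightarrow> (nat \<Rightarrow> complex) \<Rightarrow> complex \<Rightarrow> complex \<Rightarrow> complex" where
  "bform d a x y = (\<Sum>k\<le>d. a k * x ^ (d - k) * y ^ k)"

definition fscale :: "complex \<Rightarrow> (point \<Rightarrow> complex) \<Rightarrow> (point \<Rightarrow> complex)" where
  "fscale c F = (\<lambda>w. c * F w)"

definition bimonomials :: "nat \<Rightarrow> nat \<Rightarrow> nat \<Rightarrow> (point \<Rightarrow> complex) set" where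
  "bimonomials d i j =
     {(\<lambda>(a, x, y). (\<Prod>k\<le>d. a k ^ e k) * x ^ p * y ^ q) | e p q.
        (\<forall>k>d. e k = 0) \<and> (\<Sum>k\<le>d. e k) = i \<and> p + q = j}"

definition bihom :: "nat \<Rightarrow> nat \<Rightarrow> nat \<Rightarrow> (point \<Rightarrow> complex) set" where
  "bihom d i j = module.span fscale (bimonomials d i j)"

text \<open>SL(2,C)-invariance: g = [[al,be],[ga,de]] with al de - be ga = 1 acts on C^2 by
  g(x,y) = (al x + be y, ga x + de y) and on forms by (g.f)(v) = f(g^{-1} v).\<close>
definition sl2_invariant :: "nat \<Rightarrow> (point \<Rightarrow> complex) \<Rightarrow> bool" where
  "sl2_invariant d F \<longleftrightarrow>
     (\<forall>al be ga de :: complex. al * de - be * ga = 1 \<longrightarrow>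
       (\<forall>a b x y. (\<forall>u v. bform d b u v = bform d a (de * u - be * v) (- ga * u + al * v)) \<longrightarrow>
          F (b, al * x + be * y, ga * x + de * y) = F (a, x, y)))"

definition covdim :: "nat \<Rightarrow> nat \<Rightarrow> nat \<Rightarrow> nat" where
  "covdim d i j = vector_space.dim fscale {F \<in> bihom d i j. sl2_invariant d F}"

text \<open>Bivariate power series: outer variable z, inner variable t.
  The Poincare series P_d(z,t).\<close>
definition poincare :: "nat \<Rightarrow> complex fps fps" where
  "poincare d = Abs_fps (\<lambda>i. Abs_fps (\<lambda>j. of_nat (covdim d i j)))"

text \<open>psi_n(t^m) = z^i t^j with m = n i - j, 0 <= j < n, extended termwise.\<close>
definition psi :: "nat \<Rightarrow> complex fps \<Rightarrow> complex fps fps" where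
  "psi n A = Abs_fps (\<lambda>i. Abs_fps (\<lambda>j. if j < n \<and> j \<le> n * i then fps_nth A (n * i - j) else 0))"

definition qpoch :: "complex fps \<Rightarrow> complex fps \<Rightarrow> nat \<Rightarrow> complex fps" where
  "qpoch a q n = (\<Prod>l<n. 1 - a * q ^ l)"

end

theory Submission
  imports Defs "HOL-Analysis.Derivative"
begin

text \<open>A polynomial function is invariant iff the two nilpotent generators \<open>E\<close>, \<open>F\<close> of \<open>sl2\<close> kill it.
  On the space of functions of bidegree \<open>(i, j)\<close>, graded by weight, \<open>E\<close> maps weight 0 onto weight 2,
  and an element of weight 0 killed by \<open>E\<close> is also killed by \<open>F\<close>; so the invariants have dimension
  \<open>#(monomials of weight 0) - #(monomials of weight 2)\<close>. This difference is a difference of two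
  coefficients of the generating function of the exponent vectors of size \<open>i\<close>, a Gaussian binomial
  coefficient in \<open>t^2\<close>, whose expansion
  \<open>\<Sum>k\<le>d. (-1)^k t^(k(k+1) + 2ik) / ((t^2;t^2)_k (t^2;t^2)_(d-k))\<close> yields the summands of the formula;
  those with \<open>2k \<ge> d\<close> do not contribute for degree reasons.\<close>

section \<open>The expansion of the Gaussian binomial coefficients\<close>

text \<open>With \<open>q = t^2\<close>, the Gaussian binomial for degree \<open>i\<close> is
  \<open>(q^(i+1);q)_d / (q;q)_d\<close>, and the q-binomial theorem expands its numerator in powers
  of \<open>q^(i+1)\<close>. So the \<open>k\<close>-th term depends on \<open>i\<close> only
  through the monomial \<open>t^(2ki)\<close>, and its coefficient at \<open>t^(d*i - j)\<close> is
  the coefficient at \<open>t^((d - 2k)*i - j)\<close> of a series free of \<open>i\<close>. This is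
  the origin of \<open>psi\<close> with index \<open>d - 2k\<close>. On the invariant side the
  obstacle is that a point carries infinitely many coefficients and functions on points are
  arbitrary, so differentiation behaves well only on polynomial functions. Hence linearity is asked
  for on subspaces only, and the passage from the group to its Lie algebra runs along two explicit
  unipotent flows, differentiated coordinate by coordinate.\<close>

definition qfac :: "nat \<Rightarrow> complex fps" where
  "qfac n = qpoch (fps_X ^ 2) (fps_X ^ 2) n"

lemma qfac_0 [simp]: "qfac 0 = 1"
  by (simp add: qfac_def qpoch_def)

lemma qfac_Suc: "qfac (Suc n) = qfac n * (1 - fps_X ^ (2 * Suc n))"
  by (simp add: qfac_def qpoch_def power_mult [symmetric] power_add [symmetric] mult_ac)

lemma qfac_nth_0 [simp]: "fps_nth (qfac n) 0 = 1"
  by (induction n) (simp_all add: qfac_Suc)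

lemma inverse_qfac_Suc:
  "inverse (qfac (Suc n)) * (1 - fps_X ^ (2 * Suc n)) = inverse (qfac n)"
proof -
  have "fps_nth (1 - fps_X ^ (2 * Suc n) :: complex fps) 0 \<noteq> 0" by simp
  then have "inverse (1 - fps_X ^ (2 * Suc n)) * (1 - fps_X ^ (2 * Suc n)) = (1 :: complex fps)"
    by (rule inverse_mult_eq_1)
  then show ?thesis
    by (simp add: qfac_Suc fps_inverse_mult mult.assoc)
qed

text \<open>For \<open>k <= d\<close> this is the Gaussian binomial of \<open>d\<close> over
  \<open>k\<close> in \<open>q = t^2\<close>, divided by \<open>(q;q)_d\<close>. With this
  normalisation, passing to a neighbour cancels a single factor.\<close>

definition qweight :: "nat \<Rightarrow> nat \<Rightarrow> complex fps" where
  "qweight d k = inverse (qfac k) * inverse (qfac (d - k))"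

lemma qweight_lower:
  assumes "k \<le> d"
  shows "qweight (Suc d) k * (1 - fps_X ^ (2 * (Suc d - k))) = qweight d k"
  using inverse_qfac_Suc [of "d - k"] assms
  by (simp add: qweight_def Suc_diff_le mult.assoc)

lemma qweight_shift: "qweight (Suc d) (Suc k) * (1 - fps_X ^ (2 * Suc k)) = qweight d k"
  using inverse_qfac_Suc [of k]
  by (simp add: qweight_def mult_ac)

text \<open>With \<open>q = t^2\<close>, the coefficients are \<open>(-1)^k q^(k(k-1)/2 + m k)\<close>; the case \<open>m = i + 1\<close> is the
  one needed for degree \<open>i\<close>, and the other values of \<open>m\<close> serve the recursion.\<close>

definition altsum :: "nat \<Rightarrow> nat \<Rightarrow> complex fps" where
  "altsum d m = (\<Sum>k\<le>d. (-1) ^ k * fps_X ^ (k * (k - 1) + 2 * m * k) * qweight d k)"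

lemma altcoeff_Suc:
  "(fps_X :: complex fps) ^ (k * (k - 1) + 2 * Suc m * k)
    = fps_X ^ (2 * k) * fps_X ^ (k * (k - 1) + 2 * m * k)"
  by (subst power_add [symmetric]) simp

text \<open>A q-Pascal rule of the same shape as \<open>level_count_Suc_Suc\<close>. In the
  difference the \<open>k\<close>-th term gains \<open>t^(2k) - t^(2(d+1))\<close>, which is zero
  for \<open>k = d + 1\<close> and otherwise cancels the last factor of
  \<open>qfac (Suc d - k)\<close>.\<close>

lemma altsum_Suc_Suc:
  "altsum (Suc d) (Suc m) = altsum d (Suc m) + fps_X ^ (2 * Suc d) * altsum (Suc d) m"
proof -
  let ?c = "\<lambda>k m. (-1) ^ k * fps_X ^ (k * (k - 1) + 2 * m * k) :: complex fps"
  have "altsum (Suc d) (Suc m) - fps_X ^ (2 * Suc d) * altsum (Suc d) m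
      = (\<Sum>k\<le>Suc d. ?c k m * qweight (Suc d) k * (fps_X ^ (2 * k) - fps_X ^ (2 * Suc d)))"
    unfolding altsum_def sum_distrib_left sum_subtractf [symmetric]
    by (intro sum.cong refl, subst altcoeff_Suc) (simp add: right_diff_distrib mult_ac)
  also have "\<dots> = (\<Sum>k\<le>d. ?c k m * qweight (Suc d) k * (fps_X ^ (2 * k) - fps_X ^ (2 * Suc d)))"
    by simp
  also have "\<dots> = altsum d (Suc m)"
    unfolding altsum_def
  proof (intro sum.cong refl)
    fix k assume "k \<in> {..d}"
    then have k: "k \<le> d" by simp
    have "fps_X ^ (2 * Suc d) = fps_X ^ (2 * k) * (fps_X ^ (2 * (Suc d - k)) :: complex fps)"
      using k by (subst power_add [symmetric]) (rule arg_cong2 [where f = power]; simp)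
    then have "?c k m * qweight (Suc d) k * (fps_X ^ (2 * k) - fps_X ^ (2 * Suc d))
       = ?c k m * fps_X ^ (2 * k) * (qweight (Suc d) k * (1 - fps_X ^ (2 * (Suc d - k))))"
      by (simp only:) (simp add: algebra_simps)
    also have "\<dots> = ?c k (Suc m) * qweight d k"
      unfolding qweight_lower [OF k] by (subst altcoeff_Suc) (simp only: mult_ac)
    finally show "?c k m * qweight (Suc d) k * (fps_X ^ (2 * k) - fps_X ^ (2 * Suc d))
       = ?c k (Suc m) * qweight d k" .
  qed
  finally show ?thesis by (simp add: algebra_simps)
qed

text \<open>The companion relation: here the factor \<open>1 - t^(2k)\<close> cancels against
  \<open>qfac k\<close> and the summation index shifts by one. Its use is at
  \<open>m = 0\<close>.\<close>

lemma altsum_diff: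
  "altsum (Suc d) m - altsum (Suc d) (Suc m) = - (fps_X ^ (2 * m) * altsum d (Suc m))"
proof -
  let ?c = "\<lambda>k m. (-1) ^ k * fps_X ^ (k * (k - 1) + 2 * m * k) :: complex fps"
  have "altsum (Suc d) m - altsum (Suc d) (Suc m)
      = (\<Sum>k\<le>Suc d. ?c k m * (qweight (Suc d) k * (1 - fps_X ^ (2 * k))))"
    unfolding altsum_def sum_subtractf [symmetric]
    by (intro sum.cong refl, subst altcoeff_Suc) (simp add: right_diff_distrib mult_ac)
  also have "\<dots> = (\<Sum>k\<le>d. ?c (Suc k) m * (qweight (Suc d) (Suc k) * (1 - fps_X ^ (2 * Suc k))))"
    by (subst sum.atMost_Suc_shift) simp
  also have "\<dots> = (\<Sum>k\<le>d. - (fps_X ^ (2 * m) * (?c k (Suc m) * qweight d k)))"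
  proof (intro sum.cong refl)
    fix k
    have "Suc k * (Suc k - 1) + 2 * m * Suc k = 2 * m + (k * (k - 1) + 2 * Suc m * k)"
      by (cases k) (simp_all add: algebra_simps)
    then have "?c (Suc k) m = - (fps_X ^ (2 * m) * ?c k (Suc m))"
      by (simp only: power_add) (simp add: algebra_simps)
    then show "?c (Suc k) m * (qweight (Suc d) (Suc k) * (1 - fps_X ^ (2 * Suc k)))
      = - (fps_X ^ (2 * m) * (?c k (Suc m) * qweight d k))"
      unfolding qweight_shift by (simp only: mult_minus_left mult.assoc)
  qed
  finally show ?thesis
    by (simp add: altsum_def sum_negf sum_distrib_left)
qed

lemma altsum_0_left [simp]: "altsum 0 m = 1"
  by (simp add: altsum_def qweight_def)

text \<open>This reflects \<open>(1;q)_(d+1) = 0\<close>. At \<open>m = 0\<close> the two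
  recurrences together say that the value equals \<open>t^(2(d+1))\<close> times itself.\<close>

lemma altsum_0_right: "altsum (Suc d) 0 = 0"
proof -
  have "altsum (Suc d) 0 * (1 - fps_X ^ (2 * Suc d)) = 0"
    using altsum_Suc_Suc [of d 0] altsum_diff [of d 0] by (simp add: algebra_simps)
  moreover have "(1 - fps_X ^ (2 * Suc d) :: complex fps) \<noteq> 0"
  proof
    assume "1 - fps_X ^ (2 * Suc d) = (0 :: complex fps)"
    then have "fps_nth (1 - fps_X ^ (2 * Suc d) :: complex fps) 0 = 0" by (simp only: fps_zero_nth)
    then show False by simp
  qed
  ultimately show ?thesis by simp
qed

lemma altsum_1_right: "altsum d (Suc 0) = 1"
  by (induction d) (simp_all add: altsum_Suc_Suc altsum_0_right)

section \<open>Counting exponents by weight\<close>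

definition exponents :: "nat \<Rightarrow> nat \<Rightarrow> (nat \<Rightarrow> nat) set" where
  "exponents d i = {e. (\<forall>k>d. e k = 0) \<and> (\<Sum>k\<le>d. e k) = i}"

definition moment :: "nat \<Rightarrow> (nat \<Rightarrow> nat) \<Rightarrow> nat" where
  "moment d e = (\<Sum>k\<le>d. k * e k)"

lemma finite_exponents [simp]: "finite (exponents d i)"
proof (rule finite_subset)
  show "exponents d i \<subseteq> {e. \<forall>k. (k \<in> {..d} \<longrightarrow> e k \<in> {..i}) \<and> (k \<notin> {..d} \<longrightarrow> e k = 0)}"
    by (auto simp: exponents_def not_le intro: member_le_sum [of _ "{..d}"])
  show "finite {e :: nat \<Rightarrow> nat. \<forall>k. (k \<in> {..d} \<longrightarrow> e k \<in> {..i}) \<and> (k \<notin> {..d} \<longrightarrow> e k = 0)}"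
    by (rule finite_set_of_finite_funs) auto
qed

text \<open>The moment is doubled to match the variable \<open>t\<close> with
  \<open>q = t^2\<close>; level \<open>d * i - j\<close> then consists of the coefficient monomials
  of weight \<open>j\<close>.\<close>

definition level_count :: "nat \<Rightarrow> nat \<Rightarrow> nat \<Rightarrow> nat" where
  "level_count d i m = card {e \<in> exponents d i. 2 * moment d e = m}"

lemma exponents_0_left: "exponents 0 i = {\<lambda>k. if k = 0 then i else 0}"
  by (auto simp: exponents_def)

lemma exponents_0_right: "exponents d 0 = {\<lambda>k. 0}"
  by (auto simp: exponents_def fun_eq_iff intro: leI)

lemma level_count_0_left: "level_count 0 i m = (if m = 0 then 1 else 0)"
proof -
  have "{e \<in> exponents 0 i. 2 * moment 0 e = m} = (if m = 0 then {\<lambda>k. if k = 0 then i else 0} else {})"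
    by (auto simp: exponents_0_left moment_def)
  then show ?thesis by (simp add: level_count_def)
qed

lemma level_count_0_right: "level_count d 0 m = (if m = 0 then 1 else 0)"
proof -
  have "{e \<in> exponents d 0. 2 * moment d e = m} = (if m = 0 then {\<lambda>k. 0} else {})"
    by (auto simp: exponents_0_right moment_def)
  then show ?thesis by (simp add: level_count_def)
qed

lemma exponents_Suc_left:
  "{e \<in> exponents (Suc d) i. e (Suc d) = 0} = exponents d i"
proof -
  have "(\<forall>k>Suc d. e k = 0) \<and> e (Suc d) = 0 \<longleftrightarrow> (\<forall>k>d. e k = 0)" for e :: "nat \<Rightarrow> nat"
    by (metis Suc_lessD Suc_lessI lessI)
  then show ?thesis by (auto simp: exponents_def)
qed

lemma moment_Suc: "moment (Suc d) e = moment d e + Suc d * e (Suc d)"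
  by (simp add: moment_def)

text \<open>Either \<open>e (Suc d)\<close> is zero and \<open>e\<close> belongs to
  \<open>d\<close>, or decrementing it lowers the size by 1 and the doubled moment by
  \<open>2 * Suc d\<close>.\<close>

lemma level_count_Suc_Suc:
  "level_count (Suc d) (Suc i) m = level_count d (Suc i) m
     + (if 2 * Suc d \<le> m then level_count (Suc d) i (m - 2 * Suc d) else 0)"
proof -
  let ?A = "{e \<in> exponents (Suc d) (Suc i). 2 * moment (Suc d) e = m}"
  let ?f = "\<lambda>e :: nat \<Rightarrow> nat. e(Suc d := Suc (e (Suc d)))"
  let ?g = "\<lambda>e :: nat \<Rightarrow> nat. e(Suc d := e (Suc d) - 1)"
  let ?B = "{e \<in> exponents (Suc d) i. 2 * moment (Suc d) e + 2 * Suc d = m}"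
  have mom: "moment d (e(Suc d := x)) = moment d e" for e x
    by (simp add: moment_def)
  have "{e \<in> ?A. e (Suc d) = 0} = {e \<in> exponents d (Suc i). 2 * moment d e = m}"
    by (auto simp: exponents_Suc_left [of d "Suc i", symmetric] moment_Suc)
  then have 1: "card {e \<in> ?A. e (Suc d) = 0} = level_count d (Suc i) m"
    by (simp add: level_count_def)
  have "bij_betw ?f ?B {e \<in> ?A. e (Suc d) \<noteq> 0}"
    by (rule bij_betw_byWitness [where f' = ?g])
      (auto simp: exponents_def mom moment_Suc algebra_simps gr0_conv_Suc)
  then have 2: "card {e \<in> ?A. e (Suc d) \<noteq> 0} = card ?B"
    by (simp add: bij_betw_same_card)
  have 3: "card ?B = (if 2 * Suc d \<le> m then level_count (Suc d) i (m - 2 * Suc d) else 0)"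
    by (auto simp: level_count_def intro!: arg_cong [where f = card])
  have "card ?A = card ({e \<in> ?A. e (Suc d) = 0} \<union> {e \<in> ?A. e (Suc d) \<noteq> 0})"
    by (rule arg_cong [where f = card]) auto
  also have "\<dots> = card {e \<in> ?A. e (Suc d) = 0} + card {e \<in> ?A. e (Suc d) \<noteq> 0}"
    by (rule card_Un_disjoint) auto
  finally show ?thesis
    unfolding 1 2 3 by (simp add: level_count_def)
qed

lemma level_count_gf: "Abs_fps (\<lambda>m. of_nat (level_count d i m)) = altsum d (Suc i)"
proof (induction d arbitrary: i)
  case 0
  show ?case by (rule fps_ext) (simp add: level_count_0_left)
next
  case (Suc d)
  show ?case
  proof (induction i)
    case 0
    show ?case by (rule fps_ext) (simp add: level_count_0_right altsum_1_right)
  next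
    case (Suc i)
    have "Abs_fps (\<lambda>m. of_nat (level_count (Suc d) (Suc i) m))
       = Abs_fps (\<lambda>m. of_nat (level_count d (Suc i) m))
         + fps_X ^ (2 * Suc d) * Abs_fps (\<lambda>m. of_nat (level_count (Suc d) i m) :: complex)"
      by (rule fps_ext) (auto simp: level_count_Suc_Suc fps_X_power_mult_nth not_le simp del: mult_Suc_right)
    \<comment> \<open>\<open>Suc.IH\<close> now names the inner hypothesis on \<open>i\<close>; the
      outer one on \<open>d\<close> is therefore quoted by its form.\<close>
    then show ?case
      by (simp only: Suc.IH \<open>\<And>i. _ = altsum d (Suc i)\<close> altsum_Suc_Suc [of d "Suc i"])
  qed
qed

text \<open>Reversing an exponent vector, \<open>k\<close> to \<open>d - k\<close>, replaces the
  moment by its complement in \<open>d * i\<close>.\<close>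

lemma level_count_reverse:
  assumes "m \<le> 2 * d * i"
  shows "level_count d i (2 * d * i - m) = level_count d i m"
proof -
  let ?r = "\<lambda>e k. if k \<le> d then e (d - k) else (0 :: nat)"
  have sum: "(\<Sum>k\<le>d. ?r e k) = (\<Sum>k\<le>d. e k)" for e
    by (rule sum.reindex_bij_witness [of _ "\<lambda>k. d - k" "\<lambda>k. d - k"]) auto
  have mom: "moment d (?r e) + moment d e = d * i" if "e \<in> exponents d i" for e
  proof -
    have "moment d (?r e) = (\<Sum>k\<le>d. (d - k) * e k)"
      unfolding moment_def
      by (rule sum.reindex_bij_witness [of _ "\<lambda>k. d - k" "\<lambda>k. d - k"]) auto
    then have "moment d (?r e) + moment d e = (\<Sum>k\<le>d. d * e k)"
      by (simp add: moment_def sum.distrib [symmetric] add_mult_distrib [symmetric])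
    then show ?thesis
      using that by (simp add: exponents_def sum_distrib_left [symmetric])
  qed
  have "bij_betw ?r {e \<in> exponents d i. 2 * moment d e = m}
          {e \<in> exponents d i. 2 * moment d e = 2 * d * i - m}"
  proof (rule bij_betw_byWitness [where f' = ?r])
    have rev: "?r e \<in> exponents d i" if "e \<in> exponents d i" for e
      using that sum [of e] by (simp add: exponents_def)
    show "?r ` {e \<in> exponents d i. 2 * moment d e = m} \<subseteq> {e \<in> exponents d i. 2 * moment d e = 2 * d * i - m}"
      using mom rev by fastforce
    show "?r ` {e \<in> exponents d i. 2 * moment d e = 2 * d * i - m} \<subseteq> {e \<in> exponents d i. 2 * moment d e = m}"
      using mom rev assms by fastforce
  qed (auto simp: exponents_def fun_eq_iff)
  then show ?thesis
    unfolding level_count_def by (simp add: bij_betw_same_card)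
qed

text \<open>The coefficient \<open>a k\<close> has weight \<open>d - 2 k\<close>, while \<open>x\<close> has weight -1 and \<open>y\<close> has weight 1.\<close>

definition weight :: "nat \<Rightarrow> (nat \<Rightarrow> nat) \<times> nat \<times> nat \<Rightarrow> int" where
  "weight d = (\<lambda>(e, p, q). (\<Sum>k\<le>d. (int d - 2 * int k) * int (e k)) - int p + int q)"

lemma weight_eq:
  assumes "e \<in> exponents d i"
  shows "weight d (e, p, q) = int (d * i) - 2 * int (moment d e) - int p + int q"
proof -
  have "(\<Sum>k\<le>d. (int d - 2 * int k) * int (e k)) = int (d * (\<Sum>k\<le>d. e k)) - 2 * int (moment d e)"
    by (simp add: moment_def left_diff_distrib sum_subtractf sum_distrib_left mult.assoc)
  then show ?thesis using assms
    by (auto simp: weight_def exponents_def simp del: of_nat_mult of_nat_sum)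
qed

definition weight_exponents :: "nat \<Rightarrow> nat \<Rightarrow> nat \<Rightarrow> int \<Rightarrow> ((nat \<Rightarrow> nat) \<times> nat \<times> nat) set" where
  "weight_exponents d i j m =
     {(e, p, q). e \<in> exponents d i \<and> p + q = j \<and> weight d (e, p, q) = m}"

lemma finite_weight_exponents [simp]: "finite (weight_exponents d i j m)"
  by (rule finite_subset [of _ "exponents d i \<times> {..j} \<times> {..j}"]) (auto simp: weight_exponents_def)

text \<open>Trading a factor \<open>x\<close> for a factor \<open>y\<close> raises the weight by 2, so only the exponents
  with no \<open>x\<close>, respectively no \<open>y\<close>, survive in the difference.\<close>

lemma card_weight_exponents:
  "card (weight_exponents d i j 0) + (if j + 2 \<le> d * i then level_count d i (d * i - j - 2) else 0)
   = card (weight_exponents d i j 2) + (if j \<le> d * i then level_count d i (d * i - j) else 0)"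
proof -
  let ?W = "weight_exponents d i j"
  let ?f = "\<lambda>(e :: nat \<Rightarrow> nat, p :: nat, q). (e, p - 1, Suc q)"
  let ?g = "\<lambda>(e :: nat \<Rightarrow> nat, p :: nat, q). (e, Suc p, q - 1)"
  have split: "card (?W m) = card {v \<in> ?W m. P v} + card {v \<in> ?W m. \<not> P v}" for m P
    by (subst card_Un_disjoint [symmetric]) (auto intro!: arg_cong [where f = card])
  have "bij_betw ?f {v \<in> ?W 0. \<not> fst (snd v) = 0} {v \<in> ?W 2. \<not> snd (snd v) = 0}"
    by (rule bij_betw_byWitness [where f' = ?g])
      (auto simp: weight_exponents_def weight_eq simp del: of_nat_mult)
  then have mid: "card {v \<in> ?W 0. \<not> fst (snd v) = 0} = card {v \<in> ?W 2. \<not> snd (snd v) = 0}"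
    by (rule bij_betw_same_card)
  have "bij_betw fst {v \<in> ?W 0. fst (snd v) = 0} {e \<in> exponents d i. 2 * moment d e = d * i + j}"
    by (rule bij_betw_byWitness [where f' = "\<lambda>e. (e, 0, j)"])
      (auto simp: weight_exponents_def weight_eq simp del: of_nat_mult)
  then have "card {v \<in> ?W 0. fst (snd v) = 0} = level_count d i (d * i + j)"
    by (simp add: level_count_def bij_betw_same_card)
  \<comment> \<open>Reflection about the middle level \<open>d * i\<close> brings this term to the
    same side as the other one. For \<open>j > d * i\<close> the level exceeds the maximum
    \<open>2 * d * i\<close>.\<close>
  also have "\<dots> = (if j \<le> d * i then level_count d i (d * i - j) else 0)"
  proof (cases "j \<le> d * i")
    case True
    then show ?thesis using level_count_reverse [of "d * i - j" d i]
      by (simp add: mult.assoc)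
  next
    case False
    have "moment d e \<le> d * i" if "e \<in> exponents d i" for e
    proof -
      have "moment d e \<le> (\<Sum>k\<le>d. d * e k)"
        unfolding moment_def by (intro sum_mono) simp
      then show ?thesis using that by (simp add: exponents_def sum_distrib_left [symmetric])
    qed
    with False have "{e \<in> exponents d i. 2 * moment d e = d * i + j} = {}" by fastforce
    then show ?thesis using False by (simp add: level_count_def)
  qed
  finally have low: "card {v \<in> ?W 0. fst (snd v) = 0} = \<dots>" .
  have "bij_betw fst {v \<in> ?W 2. snd (snd v) = 0} {e \<in> exponents d i. 2 * moment d e + j + 2 = d * i}"
    by (rule bij_betw_byWitness [where f' = "\<lambda>e. (e, j, 0)"])
      (auto simp: weight_exponents_def weight_eq simp del: of_nat_mult)
  then have "card {v \<in> ?W 2. snd (snd v) = 0} = card {e \<in> exponents d i. 2 * moment d e + j + 2 = d * i}"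
    by (rule bij_betw_same_card)
  also have "\<dots> = (if j + 2 \<le> d * i then level_count d i (d * i - j - 2) else 0)"
    by (auto simp: level_count_def intro!: arg_cong [where f = card])
  finally have high: "card {v \<in> ?W 2. snd (snd v) = 0} = \<dots>" .
  show ?thesis
    using split [of 0 "\<lambda>v. fst (snd v) = 0"] split [of 2 "\<lambda>v. snd (snd v) = 0"] mid low high
    by simp
qed

section \<open>Coefficients of the right-hand side\<close>

text \<open>The coefficients are themselves power series and form no field, so
  \<open>inverse\<close> is unfolded as the right inverse started from the \<open>inverse\<close> of
  the constant coefficient, which is 1 here.\<close>

lemma inverse_one_minus_X_const:
  fixes c :: "complex fps"
  shows "inverse (1 - fps_X * fps_const c) = Abs_fps (\<lambda>i. c ^ i)"
proof -
  let ?f = "1 - fps_X * fps_const c" and ?g = "Abs_fps (\<lambda>i. c ^ i)"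
  have "?f * ?g = 1"
  proof (rule fps_ext)
    fix i
    show "fps_nth (?f * ?g) i = fps_nth 1 i"
      by (cases i) (simp_all add: left_diff_distrib mult.assoc)
  qed
  moreover have "fps_nth ?g 0 * fps_nth ?f 0 = 1" by simp
  ultimately have "fps_right_inverse ?f (fps_nth ?g 0) = ?g"
    by (rule fps_lr_inverse_unique_ring1(2))
  moreover have "inverse (fps_nth ?f 0) = fps_nth ?g 0"
    using fps_inverse_one' by simp
  ultimately show ?thesis by (simp only: fps_inverse_def)
qed

text \<open>Multiplying by \<open>1 / (1 - z t^n)\<close> removes the restriction \<open>j < n\<close> in \<open>psi n\<close>: the only
  \<open>l \<le> i\<close> that contributes to the coefficient is \<open>l = i - j div n\<close>.\<close>

lemma psi_mult_geometric_nth: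
  assumes "n > 0"
  shows "fps_nth (fps_nth (psi n A * inverse (1 - fps_X * fps_const (fps_X ^ n))) i) j
    = (if j \<le> n * i then fps_nth A (n * i - j) else 0)"
proof -
  let ?t = "\<lambda>l. if n * (i - l) \<le> j then fps_nth (fps_nth (psi n A) l) (j - n * (i - l)) else 0"
  have unique: "l = i - j div n \<and> j div n \<le> i" if "l \<le> i" "?t l \<noteq> 0" for l
  proof -
    from that(2) have le: "n * (i - l) \<le> j" and "j - n * (i - l) < n"
      by (auto simp: psi_def split: if_splits)
    then have "j div n = i - l"
      using assms by (intro div_nat_eqI) (simp_all add: mult.commute)
    then show ?thesis using that(1) by simp
  qed
  have "fps_nth (fps_nth (psi n A * inverse (1 - fps_X * fps_const (fps_X ^ n))) i) j = (\<Sum>l\<in>{0..i}. ?t l)"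
    by (simp add: inverse_one_minus_X_const fps_mult_nth [where 'a = "complex fps"] fps_sum_nth
        power_mult [symmetric] fps_X_power_mult_right_nth not_less if_distrib [where f = Not])
      (auto intro!: sum.cong)
  also have "\<dots> = (\<Sum>l\<in>(if j div n \<le> i then {i - j div n} else {}). ?t l)"
    using unique by (intro sum.mono_neutral_right) (fastforce split: if_splits)+
  also have "\<dots> = (if j \<le> n * i then fps_nth A (n * i - j) else 0)"
  proof (cases "j div n \<le> i")
    case True
    have *: "n * (j div n) \<le> j" "j - n * (j div n) < n"
      using assms by (simp_all add: minus_mult_div_eq_mod)
    have "n * (i - j div n) - (j - n * (j div n)) = n * i - j"
      using * True by (simp add: right_diff_distrib')
    moreover have "j - n * (j div n) \<le> n * (i - j div n) \<longleftrightarrow> j \<le> n * i"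
      using * mult_le_mono2 [OF True, of n] unfolding right_diff_distrib' by linarith
    ultimately show ?thesis
      using True * by (simp add: psi_def)
  next
    case False
    then have "\<not> j \<le> n * i"
      using assms by (metis div_le_mono nonzero_mult_div_cancel_left not_gr_zero)
    then show ?thesis using False by simp
  qed
  finally show ?thesis .
qed

text \<open>Multiplication by \<open>1 - t^2\<close> subtracts the coefficient two places below,
  which is the step from weight 0 to weight 2.\<close>

lemma level_count_diff_nth:
  "(if j \<le> d * i then of_nat (level_count d i (d * i - j)) else 0)
     - (if j + 2 \<le> d * i then of_nat (level_count d i (d * i - j - 2)) else 0)
   = (if j \<le> d * i then fps_nth ((1 - fps_X ^ 2) * altsum d (Suc i)) (d * i - j) else (0 :: complex))"
  by (auto simp: level_count_gf [symmetric] left_diff_distrib fps_X_power_mult_nth)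

section \<open>Matching the expansion with the summands of the formula\<close>

definition summand :: "nat \<Rightarrow> nat \<Rightarrow> complex fps" where
  "summand d k = fps_const ((-1) ^ k) * fps_X ^ (k * (k + 1)) * (1 - fps_X ^ 2) /
     (qpoch (fps_X ^ 2) (fps_X ^ 2) k * qpoch (fps_X ^ 2) (fps_X ^ 2) (d - k))"

lemma summand_eq:
  "summand d k = fps_X ^ (k * (k + 1)) * (fps_const ((-1) ^ k) * (1 - fps_X ^ 2) * qweight d k)"
  by (simp add: summand_def qfac_def [symmetric] fps_divide_unit qweight_def fps_inverse_mult mult_ac)

lemma fps_const_minus_one_power: "fps_const ((-1) ^ k) = ((-1) ^ k :: complex fps)"
  by (induction k) (simp_all flip: fps_const_neg fps_const_mult)

text \<open>Since \<open>k(k-1) + 2(i+1)k = 2ki + k(k+1)\<close>, the degree \<open>i\<close> splits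
  off as a monomial and one series per \<open>k\<close> serves all degrees.\<close>

lemma summand_altsum:
  "(1 - fps_X ^ 2) * altsum d (Suc i) = (\<Sum>k\<le>d. fps_X ^ (2 * k * i) * summand d k)"
  unfolding altsum_def sum_distrib_left
proof (intro sum.cong refl)
  fix k
  have "k * (k - 1) + 2 * Suc i * k = 2 * k * i + k * (k + 1)"
    by (cases k) (simp_all add: algebra_simps)
  then have "fps_X ^ (k * (k - 1) + 2 * Suc i * k) = fps_X ^ (2 * k * i) * (fps_X ^ (k * (k + 1)) :: complex fps)"
    by (simp only: power_add)
  then show "(1 - fps_X\<^sup>2) * ((-1) ^ k * fps_X ^ (k * (k - 1) + 2 * Suc i * k) * qweight d k)
     = fps_X ^ (2 * k * i) * summand d k"
    unfolding summand_eq fps_const_minus_one_power by (simp only: mult_ac)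
qed

lemma altsum_nth_eq_sum:
  assumes "d \<ge> 1" "j \<le> d * i"
  shows "fps_nth ((1 - fps_X ^ 2) * altsum d (Suc i)) (d * i - j)
    = (\<Sum>k | 2 * k < d. if j \<le> (d - 2 * k) * i then fps_nth (summand d k) ((d - 2 * k) * i - j) else 0)"
proof -
  let ?t = "\<lambda>k. fps_nth (fps_X ^ (2 * k * i) * summand d k) (d * i - j)"
  have "fps_nth ((1 - fps_X ^ 2) * altsum d (Suc i)) (d * i - j) = (\<Sum>k\<le>d. ?t k)"
    by (simp add: summand_altsum fps_sum_nth)
  also have "\<dots> = (\<Sum>k | 2 * k < d. ?t k)"
  proof (rule sum.mono_neutral_right)
    show "\<forall>k\<in>{..d} - {k. 2 * k < d}. ?t k = 0"
    proof
      fix k assume "k \<in> {..d} - {k. 2 * k < d}"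
      then have k: "d \<le> 2 * k" "k > 0" using assms by auto
      \<comment> \<open>The term starts at order \<open>2ki + k(k+1)\<close>, beyond
        \<open>d * i\<close>. The inequality is strict because \<open>d >= 1\<close> forces
        \<open>k > 0\<close> here.\<close>
      have "d * i \<le> 2 * k * i" using k by (intro mult_le_mono) auto
      moreover have "0 < k * (k + 1)" using k by simp
      ultimately have "d * i - j < 2 * k * i + k * (k + 1)" by linarith
      then show "?t k = 0"
        unfolding summand_eq mult.assoc [symmetric] power_add [symmetric]
        by (simp only: mult.assoc fps_X_power_mult_nth if_True)
    qed
  qed auto
  also have "\<dots> = (\<Sum>k | 2 * k < d. if j \<le> (d - 2 * k) * i then fps_nth (summand d k) ((d - 2 * k) * i - j) else 0)"
  proof (intro sum.cong refl)
    fix k assume "k \<in> {k. 2 * k < d}"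
    then have "d * i = 2 * k * i + (d - 2 * k) * i"
      by (metis add_mult_distrib le_add_diff_inverse less_imp_le mem_Collect_eq)
    then show "?t k = (if j \<le> (d - 2 * k) * i then fps_nth (summand d k) ((d - 2 * k) * i - j) else 0)"
      using assms(2) by (auto simp: fps_X_power_mult_nth)
  qed
  finally show ?thesis .
qed

section \<open>Graded modules over sl2\<close>

text \<open>Rank-nullity for a map known to be linear on \<open>U\<close> only. A globally linear
  \<open>T'\<close> agreeing with \<open>T\<close> on \<open>U\<close> is built from a basis of
  \<open>U\<close>; a basis \<open>A\<close> of the kernel and lifts \<open>S\<close> of a basis of
  the image then form a basis of \<open>U\<close>.\<close>

lemma (in vector_space) dim_kernel_plus_dim_image:
  assumes U: "subspace U" and fin: "finite G" "U \<subseteq> span G"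
    and add: "\<And>u v. u \<in> U \<Longrightarrow> v \<in> U \<Longrightarrow> T (u + v) = T u + T v"
    and scal: "\<And>c u. u \<in> U \<Longrightarrow> T (scale c u) = scale c (T u)"
  shows "dim {u \<in> U. T u = 0} + dim (T ` U) = dim U"
proof -
  interpret vector_space_pair scale scale by unfold_locales
  obtain B where B: "B \<subseteq> U" "independent B" "U \<subseteq> span B"
    by (rule maximal_independent_subset)
  obtain T' where T': "Vector_Spaces.linear scale scale T'" "\<forall>x\<in>B. T' x = T x"
    using linear_independent_extend [OF B(2), of T] by blast
  interpret T': Vector_Spaces.linear scale scale T' by fact
  have T'_eq: "T' u = T u" if "u \<in> U" for u
  proof -
    have "u \<in> span B" using that B by blast
    then have "u \<in> U \<and> T' u = T u"
    proof (induction rule: span_induct_alt)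
      case base
      show ?case using subspace_0 [OF U] scal [of 0 0] by (simp add: T'.zero)
    next
      case (step c x y)
      then show ?case using B(1) T'(2) U
        by (auto simp: add scal T'.add T'.scale subspace_add subspace_scale)
    qed
    then show ?thesis by simp
  qed
  define K where "K = {u \<in> U. T u = 0}"
  have K: "subspace K"
    using U scal [of 0 0] by (auto simp: K_def subspace_def add scal)
  obtain A where A: "A \<subseteq> K" "independent A" "K \<subseteq> span A" "card A = dim K"
    by (rule basis_exists)
  obtain C where C: "C \<subseteq> T ` U" "independent C" "T ` U \<subseteq> span C" "card C = dim (T ` U)"
    by (rule basis_exists)
  define g where "g = inv_into U T"
  have g: "g c \<in> U \<and> T (g c) = c" if "c \<in> C" for c
    using that C(1) by (auto simp: g_def inv_into_into f_inv_into_f)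
  define S where "S = g ` C"
  have T'g: "T' (g c) = c" if "c \<in> C" for c
    using g [OF that] T'_eq by simp
  have S: "S \<subseteq> U" "T' ` S = C" "inj_on T' S"
    using g T'g by (auto simp: S_def image_image inj_on_def)
  have cardS: "card S = card C"
    using T'g unfolding S_def by (intro card_image) (metis inj_onI)
  have finA: "finite A"
    using independent_span_bound [OF fin(1) A(2)] A(1) fin(2) by (auto simp: K_def)
  have inj: "inj_on T' (span S)"
    using S C(2) T'.inj_on_span_independent_image by simp
  have indS: "independent S"
  proof
    assume "dependent S"
    then obtain a where a: "a \<in> S" "a \<in> span (S - {a})" unfolding dependent_def by blast
    then have "T' a \<in> span (T' ` (S - {a}))" by (simp add: T'.span_image)
    also have "T' ` (S - {a}) = C - {T' a}"
      using S(2,3) a(1) by (auto simp: inj_on_def)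
    finally have "dependent C"
      unfolding dependent_def using a(1) S(2) by blast
    with C(2) show False by simp
  qed
  have finS: "finite S"
    using independent_span_bound [OF fin(1) indS] S(1) fin(2) by auto
  have kerA: "T' x = 0" if "x \<in> span A" for x
  proof -
    have "x \<in> K" using that A(1) K span_minimal by blast
    then show ?thesis using T'_eq by (simp add: K_def)
  qed
  have disj: "A \<inter> S = {}"
  proof -
    have "0 \<notin> C" using C(2) dependent_zero by blast
    moreover have "T' x \<in> C" if "x \<in> S" for x using that S(2) by blast
    moreover have "T' x = 0" if "x \<in> A" for x using that kerA span_base by blast
    ultimately show ?thesis by fastforce
  qed
  have "independent (A \<union> S)"
  proof (rule independent_if_scalars_zero)
    show "finite (A \<union> S)" using finA finS by simp
  next
    fix f x assume sum0: "(\<Sum>x\<in>A \<union> S. scale (f x) x) = 0" and x: "x \<in> A \<union> S"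
    let ?a = "\<Sum>x\<in>A. scale (f x) x" and ?s = "\<Sum>x\<in>S. scale (f x) x"
    have eq: "?a + ?s = 0"
      using sum0 by (simp add: sum.union_disjoint [OF finA finS disj])
    have "?a \<in> span A" and s: "?s \<in> span S"
      by (auto intro: span_sum span_scale span_base)
    then have "T' ?s = 0"
      using eq T'.add [of ?a ?s] kerA by (simp add: T'.zero)
    then have "?s = 0"
      using inj s span_zero T'.zero by (metis inj_onD)
    moreover from this have "?a = 0" using eq by simp
    ultimately show "f x = 0"
      using x independentD [OF A(2) finA subset_refl, of f x] independentD [OF indS finS subset_refl, of f x]
      by blast
  qed
  moreover have "A \<union> S \<subseteq> U" using A(1) S(1) by (auto simp: K_def)
  moreover have "U \<subseteq> span (A \<union> S)"
  proof
    fix u assume u: "u \<in> U"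
    have "T' u \<in> span (T' ` S)" using u C(3) S(2) T'_eq by auto
    then obtain s where s: "s \<in> span S" "T' u = T' s"
      by (auto simp: T'.span_image)
    have "s \<in> U" using s(1) S(1) U span_minimal by blast
    then have "u - s \<in> U" "T' (u - s) = 0" using u U s(2) by (simp_all add: subspace_diff T'.diff)
    then have "u - s \<in> span A" using A(3) T'_eq by (auto simp: K_def)
    then have "(u - s) + s \<in> span (A \<union> S)"
      using s(1) span_mono [of A "A \<union> S"] span_mono [of S "A \<union> S"] by (blast intro: span_add)
    then show "u \<in> span (A \<union> S)" by simp
  qed
  ultimately have "dim U = card (A \<union> S)"
    using dim_unique by blast
  also have "\<dots> = card A + card S"
    by (rule card_Un_disjoint [OF finA finS disj])
  finally show ?thesis using A(4) C(4) cardS by (simp add: K_def)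
qed

text \<open>The Cartan element is encoded by the weight \<open>m\<close> in
  \<open>commutator\<close>. Linearity is required on each weight space only, and nilpotency
  elementwise, because the operators \<open>lie\<close> satisfy no more than this on functions at
  large.\<close>

locale sl2_module = vector_space scale
  for scale :: "'a :: field_char_0 \<Rightarrow> 'v :: ab_group_add \<Rightarrow> 'v" (infixr "*s" 75) +
  fixes V :: "int \<Rightarrow> 'v set" and E F :: "'v \<Rightarrow> 'v"
  assumes subspace: "subspace (V m)"
    and E_in: "v \<in> V m \<Longrightarrow> E v \<in> V (m + 2)"
    and F_in: "v \<in> V m \<Longrightarrow> F v \<in> V (m - 2)"
    and E_add: "u \<in> V m \<Longrightarrow> v \<in> V m \<Longrightarrow> E (u + v) = E u + E v"
    and F_add: "u \<in> V m \<Longrightarrow> v \<in> V m \<Longrightarrow> F (u + v) = F u + F v"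
    and E_scale: "v \<in> V m \<Longrightarrow> E (c *s v) = c *s E v"
    and F_scale: "v \<in> V m \<Longrightarrow> F (c *s v) = c *s F v"
    and commutator: "v \<in> V m \<Longrightarrow> E (F v) = F (E v) + of_int m *s v"
    and E_nilpotent: "v \<in> V m \<Longrightarrow> \<exists>r. (E ^^ r) v = 0"
    and F_nilpotent: "v \<in> V m \<Longrightarrow> \<exists>r. (F ^^ r) v = 0"
begin

lemma E_power_in: "v \<in> V m \<Longrightarrow> (E ^^ r) v \<in> V (m + 2 * int r)"
proof (induction r)
  case (Suc r)
  then show ?case using E_in [of "(E ^^ r) v" "m + 2 * int r"] by (simp add: algebra_simps)
qed simp

lemma E_power_add: "u \<in> V m \<Longrightarrow> v \<in> V m \<Longrightarrow> (E ^^ r) (u + v) = (E ^^ r) u + (E ^^ r) v"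
  by (induction r) (simp_all add: E_add [OF E_power_in E_power_in])

lemma E_power_scale: "v \<in> V m \<Longrightarrow> (E ^^ r) (c *s v) = c *s (E ^^ r) v"
  by (induction r) (simp_all add: E_scale [OF E_power_in])

lemma E_zero [simp]: "E 0 = 0"
  using E_scale [OF subspace_0 [OF subspace], where c = 0] by simp

lemma F_zero [simp]: "F 0 = 0"
  using F_scale [OF subspace_0 [OF subspace], where c = 0] by simp

text \<open>Moving \<open>F\<close> leftwards past the copies of \<open>E\<close> collects the
  weights \<open>m\<close>, \<open>m + 2\<close>, ..., \<open>m + 2(r-1)\<close>, whose sum is the
  coefficient. It is 0 for \<open>r = 0\<close>, where \<open>r - 1\<close> is truncated.\<close>

lemma E_power_F:
  assumes v: "v \<in> V m"
  shows "(E ^^ r) (F v) = F ((E ^^ r) v) + of_int (int r * (m + int r - 1)) *s (E ^^ (r - 1)) v"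
proof (induction r)
  case 0
  show ?case by simp
next
  case (Suc r)
  let ?c = "of_int (int r * (m + int r - 1)) :: 'a"
  have in1: "F ((E ^^ r) v) \<in> V (m + 2 * int r - 2)"
    using F_in E_power_in v by blast
  have in2: "?c *s (E ^^ (r - 1)) v \<in> V (m + 2 * int r - 2)"
  proof (cases r)
    case 0
    then show ?thesis using subspace_0 [OF subspace] by simp
  next
    case (Suc s)
    then show ?thesis
      using E_power_in [OF v, of s] by (simp add: subspace_scale [OF subspace] add_diff_eq distrib_left)
  qed
  have step: "E (?c *s (E ^^ (r - 1)) v) = ?c *s (E ^^ r) v"
  proof (cases r)
    case (Suc s)
    then show ?thesis using E_scale [OF E_power_in [OF v, of s]] by simp
  qed simp
  have "(E ^^ Suc r) (F v) = E (F ((E ^^ r) v)) + ?c *s (E ^^ r) v"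
    using Suc.IH E_add [OF in1 in2] step by simp
  also have "\<dots> = F ((E ^^ Suc r) v) + (of_int (m + 2 * int r) + ?c) *s (E ^^ r) v"
    by (simp add: commutator [OF E_power_in [OF v]] scale_left_distrib add.assoc)
  also have "of_int (m + 2 * int r) + ?c = of_int (int (Suc r) * (m + int (Suc r) - 1))"
    by (simp add: algebra_simps)
  finally show ?case by simp
qed

text \<open>Induction on the power of \<open>E\<close> that kills \<open>v\<close>. By
  \<open>E_power_F\<close>, \<open>E (F v) - c v\<close> is killed by one power less, hence is some
  \<open>E u\<close>, so \<open>v\<close> is the image of \<open>(F v - u) / c\<close>. Positivity
  of \<open>m\<close> makes \<open>c\<close> nonzero.\<close>

lemma E_surj:
  assumes "m > 0" "v \<in> V m"
  shows "\<exists>u \<in> V (m - 2). E u = v"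
proof -
  have "\<exists>u \<in> V (m - 2). E u = v" if "v \<in> V m" "(E ^^ r) v = 0" for r v
    using that
  proof (induction r arbitrary: v)
    case 0
    then show ?case using subspace_0 [OF subspace] by (intro bexI [of _ 0]) auto
  next
    case (Suc r)
    define c :: 'a where "c = of_int (int (Suc r) * (m + int (Suc r) - 1))"
    have "c \<noteq> 0" using assms(1) unfolding c_def of_int_eq_0_iff by simp
    have Fv: "F v \<in> V (m - 2)" using Suc.prems F_in by blast
    have EFv: "E (F v) \<in> V m" using E_in [OF Fv] by simp
    have cv: "(- c) *s v \<in> V m" using Suc.prems subspace_scale [OF subspace] by blast
    have "(E ^^ r) (E (F v) + (- c) *s v) = (E ^^ Suc r) (F v) - c *s (E ^^ r) v"
      using E_power_add [OF EFv cv] E_power_scale [OF Suc.prems(1), of r "- c"]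
      by (simp add: funpow_swap1)
    also have "\<dots> = 0"
      using E_power_F [OF Suc.prems(1), of "Suc r"] Suc.prems(2) by (simp add: c_def)
    finally have "(E ^^ r) (E (F v) + (- c) *s v) = 0" .
    moreover have "E (F v) + (- c) *s v \<in> V m"
      using EFv cv subspace_add [OF subspace] by blast
    ultimately obtain u where u: "u \<in> V (m - 2)" "E u = E (F v) + (- c) *s v"
      using Suc.IH by blast
    have mu: "(- 1) *s u \<in> V (m - 2)" using u subspace_scale [OF subspace] by blast
    have "E (inverse c *s (F v + (- 1) *s u)) = inverse c *s (E (F v) - E u)"
      using E_scale [OF subspace_add [OF subspace Fv mu]] E_add [OF Fv mu] E_scale [OF u(1), of "- 1"]
      by simp
    also have "\<dots> = v" using \<open>c \<noteq> 0\<close> by (simp add: u(2))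
    finally show ?case
      using subspace_scale [OF subspace subspace_add [OF subspace Fv mu]] by blast
  qed
  then show ?thesis using assms(2) E_nilpotent by blast
qed

text \<open>If \<open>F v = 0\<close>, then \<open>E_power_F\<close> reduces
  \<open>(E ^^ Suc r) v = 0\<close> to \<open>(E ^^ r) v = 0\<close>, down to
  \<open>v = 0\<close>.\<close>

lemma F_inj:
  assumes "m > 0" "v \<in> V m" "F v = 0"
  shows "v = 0"
proof -
  obtain r where "(E ^^ r) v = 0" using E_nilpotent assms(2) by blast
  then show ?thesis
  proof (induction r)
    case (Suc r)
    have "of_int (int (Suc r) * (m + int (Suc r) - 1)) *s (E ^^ r) v = 0"
      using E_power_F [OF assms(2), of "Suc r"] E_power_add [of 0 0 0 "Suc r"]
        subspace_0 [OF subspace] Suc.prems assms(3) by simp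
    moreover have "int (Suc r) * (m + int (Suc r) - 1) \<noteq> 0" using assms(1) by simp
    ultimately have "(E ^^ r) v = 0" by (metis of_int_eq_0_iff scale_eq_0_iff)
    then show ?case by (rule Suc.IH)
  qed simp
qed

lemma swap: "sl2_module scale (\<lambda>m. V (- m)) F E"
proof
  fix u v m c
  show "subspace (V (- m))" by (rule subspace)
  show "E v \<in> V (- (m - 2))" if "v \<in> V (- m)" using E_in [OF that] by simp
  show "F v \<in> V (- (m + 2))" if "v \<in> V (- m)" using F_in [OF that] by simp
  show "F (E v) = E (F v) + of_int m *s v" if "v \<in> V (- m)"
    using commutator [OF that] by simp
qed (blast intro: E_add F_add E_scale F_scale E_nilpotent F_nilpotent)+

text \<open>At weight 0 the operators commute, so \<open>E (F v) = F (E v) = 0\<close>; and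
  \<open>E\<close> is injective on weight -2 by the swapped form of \<open>F_inj\<close>.\<close>

lemma E_kernel_0: "v \<in> V 0 \<Longrightarrow> E v = 0 \<Longrightarrow> F v = 0"
  using sl2_module.F_inj [OF swap, of 2 "F v"] F_in [of v 0] commutator [of v 0] by simp

lemma dim_invariants:
  assumes "finite G" "V 0 \<subseteq> span G"
  shows "dim {v \<in> V 0. E v = 0 \<and> F v = 0} + dim (V 2) = dim (V 0)"
proof -
  have "E ` V 0 = V 2" using E_in [of _ 0] E_surj [of 2] by auto
  moreover have "{v \<in> V 0. E v = 0 \<and> F v = 0} = {v \<in> V 0. E v = 0}"
    using E_kernel_0 by blast
  ultimately show ?thesis
    using dim_kernel_plus_dim_image [OF subspace assms, of E] E_add E_scale by simp
qed

end

section \<open>The action of sl2 by derivations\<close>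

datatype coordinate = Coeff nat | VarX | VarY

fun coord :: "coordinate \<Rightarrow> point \<Rightarrow> complex" where
  "coord (Coeff k) (a, x, y) = a k"
| "coord VarX (a, x, y) = x"
| "coord VarY (a, x, y) = y"

inductive polynomial :: "(point \<Rightarrow> complex) \<Rightarrow> bool" where
  const: "polynomial (\<lambda>w. c)"
| coord: "polynomial (coord v)"
| add: "polynomial F \<Longrightarrow> polynomial G \<Longrightarrow> polynomial (F + G)"
| mult: "polynomial F \<Longrightarrow> polynomial G \<Longrightarrow> polynomial (F * G)"

text \<open>Differentiability coordinate by coordinate, so that no topology on the infinite
  coefficient vectors is involved.\<close>

definition has_velocity :: "(complex \<Rightarrow> point) \<Rightarrow> point \<Rightarrow> complex \<Rightarrow> bool" where
  "has_velocity c u s \<longleftrightarrow>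
     (\<forall>v. ((\<lambda>s. coord v (c s)) has_field_derivative coord v u) (at s))"

definition ray :: "point \<Rightarrow> point \<Rightarrow> complex \<Rightarrow> point" where
  "ray w u s = (\<lambda>k. fst w k + s * fst u k,
     fst (snd w) + s * fst (snd u), snd (snd w) + s * snd (snd u))"

lemma coord_ray: "coord v (ray w u s) = coord v w + s * coord v u"
  by (cases v; cases w; cases u) (simp_all add: ray_def)

lemma ray_0 [simp]: "ray w u 0 = w"
  by (simp add: ray_def)

lemma has_velocity_ray: "has_velocity (ray w u) u s"
  by (auto simp: has_velocity_def coord_ray intro!: derivative_eq_intros)

text \<open>The derivative is taken along a straight line, which needs only the vector field and no
  flow; \<open>polynomial_derivative\<close> shows that any curve with the same velocity gives the
  same value.\<close>

definition lie :: "(point \<Rightarrow> point) \<Rightarrow> (point \<Rightarrow> complex) \<Rightarrow> point \<Rightarrow> complex" where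
  "lie N F w = deriv (\<lambda>s. F (ray w (N w) s)) 0"

text \<open>The chain rule: one \<open>D\<close> works for all curves, depending only on the current
  point and velocity.\<close>

lemma polynomial_total_derivative:
  assumes "polynomial F"
  obtains D where "\<And>c u s. has_velocity c u s \<Longrightarrow>
    ((\<lambda>s. F (c s)) has_field_derivative D (c s) u) (at s)"
proof -
  have "\<exists>D. \<forall>c u s. has_velocity c u s \<longrightarrow>
    ((\<lambda>s. F (c s)) has_field_derivative D (c s) u) (at s)"
    using assms
  proof induction
    case (const c)
    show ?case by (rule exI [of _ "\<lambda>w u. 0"]) simp
  next
    case (coord v)
    show ?case by (rule exI [of _ "\<lambda>w u. coord v u"]) (simp add: has_velocity_def)
  next
    case (add F G)
    then obtain D D' where D: "\<forall>c u s. has_velocity c u s \<longrightarrow>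
        ((\<lambda>s. F (c s)) has_field_derivative D (c s) u) (at s)"
      and D': "\<forall>c u s. has_velocity c u s \<longrightarrow>
        ((\<lambda>s. G (c s)) has_field_derivative D' (c s) u) (at s)" by blast
    show ?case
      by (rule exI [of _ "\<lambda>w u. D w u + D' w u"])
        (auto intro!: derivative_eq_intros D [rule_format] D' [rule_format])
  next
    case (mult F G)
    then obtain D D' where D: "\<forall>c u s. has_velocity c u s \<longrightarrow>
        ((\<lambda>s. F (c s)) has_field_derivative D (c s) u) (at s)"
      and D': "\<forall>c u s. has_velocity c u s \<longrightarrow>
        ((\<lambda>s. G (c s)) has_field_derivative D' (c s) u) (at s)" by blast
    show ?case
      by (rule exI [of _ "\<lambda>w u. D w u * G w + D' w u * F w"])
        (auto intro!: DERIV_mult D [rule_format] D' [rule_format])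
  qed
  then show ?thesis using that by blast
qed

lemma polynomial_derivative:
  assumes "polynomial F" "has_velocity c (N (c s)) s"
  shows "((\<lambda>s. F (c s)) has_field_derivative lie N F (c s)) (at s)"
proof -
  obtain D where D: "\<And>c u s. has_velocity c u s \<Longrightarrow>
    ((\<lambda>s. F (c s)) has_field_derivative D (c s) u) (at s)"
    using polynomial_total_derivative [OF assms(1)] by blast
  have "lie N F (c s) = D (c s) (N (c s))"
    unfolding lie_def using D [OF has_velocity_ray, of "c s" "N (c s)" 0] by (simp add: DERIV_imp_deriv)
  then show ?thesis using D [OF assms(2)] by simp
qed

lemma lie_unique:
  assumes "\<And>w. ((\<lambda>s. F (ray w (N w) s)) has_field_derivative D w) (at 0)"
  shows "lie N F = D"
  by (rule ext) (simp add: lie_def DERIV_imp_deriv [OF assms])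

lemma lie_ray:
  "polynomial F \<Longrightarrow> ((\<lambda>s. F (ray w (N w) s)) has_field_derivative lie N F w) (at 0)"
  using polynomial_derivative [of F "ray w (N w)" N 0] has_velocity_ray by simp

lemma lie_const [simp]: "lie N (\<lambda>w. c) = 0"
  by (rule lie_unique) (simp add: zero_fun_def)

lemma lie_coord: "lie N (coord v) = (\<lambda>w. coord v (N w))"
  by (rule lie_unique) (auto simp: coord_ray intro!: derivative_eq_intros)

lemma lie_add:
  "polynomial F \<Longrightarrow> polynomial G \<Longrightarrow> lie N (F + G) = lie N F + lie N G"
  by (rule lie_unique) (simp add: DERIV_add lie_ray)

lemma lie_mult:
  "polynomial F \<Longrightarrow> polynomial G \<Longrightarrow> lie N (F * G) = lie N F * G + F * lie N G"
  by (rule lie_unique) (use DERIV_mult [OF lie_ray lie_ray] in \<open>simp add: mult.commute\<close>)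

lemma fscale_apply: "fscale c F w = c * F w"
  by (simp add: fscale_def)

lemma fscale_eq: "fscale c F = (\<lambda>w. c) * F"
  by (simp add: fscale_def times_fun_def)

lemma lie_scale: "polynomial F \<Longrightarrow> lie N (fscale c F) = fscale c (lie N F)"
  by (simp add: fscale_eq lie_mult polynomial.const)

lemma polynomial_scale: "polynomial F \<Longrightarrow> polynomial (fscale c F)"
  by (simp add: fscale_eq polynomial.intros)

interpretation funs: vector_space fscale
  by unfold_locales (auto simp: fscale_def algebra_simps fun_eq_iff)

text \<open>The vector fields of the one-parameter groups \<open>[[1,s],[0,1]]\<close> and \<open>[[1,0],[s,1]]\<close>.\<close>

definition raising :: "nat \<Rightarrow> point \<Rightarrow> point" where
  "raising d = (\<lambda>(a, x, y). (\<lambda>k. if k = 0 \<or> k > d then 0 else - of_nat (d - k + 1) * a (k - 1), y, 0))"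

definition lowering :: "nat \<Rightarrow> point \<Rightarrow> point" where
  "lowering d = (\<lambda>(a, x, y). (\<lambda>k. if k < d then - of_nat (k + 1) * a (k + 1) else 0, 0, x))"

lemma lie_raising_coord:
  "lie (raising d) (coord (Coeff k)) =
     (if k = 0 \<or> k > d then 0 else fscale (- of_nat (d - k + 1)) (coord (Coeff (k - 1))))"
  "lie (raising d) (coord VarX) = coord VarY"
  "lie (raising d) (coord VarY) = 0"
  by (auto simp: lie_coord raising_def fscale_def fun_eq_iff)

lemma lie_lowering_coord:
  "lie (lowering d) (coord (Coeff k)) =
     (if k < d then fscale (- of_nat (k + 1)) (coord (Coeff (k + 1))) else 0)"
  "lie (lowering d) (coord VarX) = 0"
  "lie (lowering d) (coord VarY) = coord VarX"
  by (auto simp: lie_coord lowering_def fscale_def fun_eq_iff)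

text \<open>The generation by multiplication with coordinates lets the Leibniz rule be applied by
  rule induction; \<open>graded_iff_span\<close> later identifies these spaces with spans of
  monomials.\<close>

inductive graded :: "nat \<Rightarrow> nat \<Rightarrow> nat \<Rightarrow> int \<Rightarrow> (point \<Rightarrow> complex) \<Rightarrow> bool" for d where
  zero: "graded d i j m 0"
| one: "graded d 0 0 0 1"
| Coeff: "graded d i j m F \<Longrightarrow> k \<le> d \<Longrightarrow>
    graded d (Suc i) j (m + int d - 2 * int k) (coord (Coeff k) * F)"
| VarX: "graded d i j m F \<Longrightarrow> graded d i (Suc j) (m - 1) (coord VarX * F)"
| VarY: "graded d i j m F \<Longrightarrow> graded d i (Suc j) (m + 1) (coord VarY * F)"
| add: "graded d i j m F \<Longrightarrow> graded d i j m G \<Longrightarrow> graded d i j m (F + G)"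
| scale: "graded d i j m F \<Longrightarrow> graded d i j m (fscale c F)"

lemmas fun_apply = plus_fun_apply times_fun_apply zero_fun_apply one_fun_apply

text \<open>Induction over \<open>graded\<close> produces eta-redexes \<open>\<lambda>w. (F * G) w\<close>, which these rules would unfold
  pointwise.\<close>

declare fun_apply [simp del]

lemma graded_polynomial: "graded d i j m F \<Longrightarrow> polynomial F"
proof (induction rule: graded.induct)
  case zero
  show ?case using polynomial.const [of 0] by (simp add: zero_fun_def)
next
  case one
  show ?case using polynomial.const [of 1] by (simp add: one_fun_def)
qed (simp_all add: polynomial.coord polynomial.add polynomial.mult polynomial_scale)

lemma lie_zero [simp]: "lie N 0 = 0"
  using lie_const [of N 0] by (simp add: zero_fun_def)

lemma lie_one [simp]: "lie N 1 = 0"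
  using lie_const [of N 1] by (simp add: one_fun_def)

lemma graded_raising: "graded d i j m F \<Longrightarrow> graded d i j (m + 2) (lie (raising d) F)"
proof (induction rule: graded.induct)
  case (Coeff i j m F k)
  note [simp] = graded_polynomial [OF Coeff.hyps(1)] polynomial.coord
  have "graded d (Suc i) j (m + int d - 2 * int k + 2) (coord (Coeff k) * lie (raising d) F)"
    using graded.Coeff [OF Coeff.IH Coeff.hyps(2)] by (simp add: algebra_simps)
  moreover have "graded d (Suc i) j (m + int d - 2 * int k + 2) (lie (raising d) (coord (Coeff k)) * F)"
  proof (cases k)
    case (Suc l)
    have "graded d (Suc i) j (m + int d - 2 * int k + 2) (coord (Coeff l) * F)"
      using graded.Coeff [OF Coeff.hyps(1), of l] Coeff.hyps(2) Suc by (simp add: algebra_simps)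
    then show ?thesis
      using graded.scale [of d "Suc i" j _ _ "- of_nat (d - k + 1)"] Coeff.hyps(2) Suc
      by (simp add: lie_raising_coord fscale_eq mult.assoc)
  qed (simp add: lie_raising_coord graded.zero)
  ultimately show ?case by (simp add: lie_mult graded.add)
next
  case (VarX i j m F)
  note [simp] = graded_polynomial [OF VarX.hyps(1)] polynomial.coord
  show ?case
    using graded.VarX [OF VarX.IH] graded.VarY [OF VarX.hyps(1)]
    by (auto simp: lie_mult lie_raising_coord algebra_simps intro: graded.add)
next
  case (VarY i j m F)
  note [simp] = graded_polynomial [OF VarY.hyps(1)] polynomial.coord
  show ?case
    using graded.VarY [OF VarY.IH] by (simp add: lie_mult lie_raising_coord algebra_simps)
qed (auto simp: lie_add lie_scale graded_polynomial intro: graded.intros)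

lemma graded_lowering: "graded d i j m F \<Longrightarrow> graded d i j (m - 2) (lie (lowering d) F)"
proof (induction rule: graded.induct)
  case (Coeff i j m F k)
  note [simp] = graded_polynomial [OF Coeff.hyps(1)] polynomial.coord
  have "graded d (Suc i) j (m + int d - 2 * int k - 2) (coord (Coeff k) * lie (lowering d) F)"
    using graded.Coeff [OF Coeff.IH Coeff.hyps(2)] by (simp add: algebra_simps)
  moreover have "graded d (Suc i) j (m + int d - 2 * int k - 2) (lie (lowering d) (coord (Coeff k)) * F)"
  proof (cases "k < d")
    case True
    have "graded d (Suc i) j (m + int d - 2 * int k - 2) (coord (Coeff (k + 1)) * F)"
      using graded.Coeff [OF Coeff.hyps(1), of "k + 1"] True by (simp add: algebra_simps)
    then show ?thesis
      using graded.scale [of d "Suc i" j _ _ "- of_nat (k + 1)"] True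
      by (simp add: lie_lowering_coord fscale_eq mult.assoc)
  qed (simp add: lie_lowering_coord graded.zero)
  ultimately show ?case by (simp add: lie_mult graded.add)
next
  case (VarX i j m F)
  note [simp] = graded_polynomial [OF VarX.hyps(1)] polynomial.coord
  show ?case
    using graded.VarX [OF VarX.IH] by (simp add: lie_mult lie_lowering_coord algebra_simps)
next
  case (VarY i j m F)
  note [simp] = graded_polynomial [OF VarY.hyps(1)] polynomial.coord
  show ?case
    using graded.VarY [OF VarY.IH] graded.VarX [OF VarY.hyps(1)]
    by (auto simp: lie_mult lie_lowering_coord algebra_simps intro: graded.add)
qed (auto simp: lie_add lie_scale graded_polynomial intro: graded.intros)

text \<open>The action of the Cartan element. As a commutator of derivations it is again a
  derivation, so its values on coordinates determine it on polynomials.\<close>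

definition bracket :: "nat \<Rightarrow> (point \<Rightarrow> complex) \<Rightarrow> point \<Rightarrow> complex" where
  "bracket d F = lie (raising d) (lie (lowering d) F) - lie (lowering d) (lie (raising d) F)"

lemma bracket_coord:
  "k \<le> d \<Longrightarrow> bracket d (coord (Coeff k)) = fscale (of_int (int d - 2 * int k)) (coord (Coeff k))"
  "bracket d (coord VarX) = fscale (- 1) (coord VarX)"
  "bracket d (coord VarY) = coord VarY"
proof -
  assume k: "k \<le> d"
  let ?c = "coord (Coeff k)"
  have "lie (raising d) (lie (lowering d) ?c) = fscale (of_nat ((k + 1) * (d - k))) ?c"
  proof (cases "k < d")
    case True
    then have "\<not> (k + 1 = 0 \<or> k + 1 > d)" "d - (k + 1) + 1 = d - k" "k + 1 - 1 = k" by simp_all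
    with True show ?thesis
      by (simp only: if_True if_False lie_lowering_coord lie_raising_coord
          lie_scale [OF polynomial.coord] funs.scale_scale of_nat_mult minus_mult_minus)
  qed (use k in \<open>simp add: lie_lowering_coord\<close>)
  moreover have "lie (lowering d) (lie (raising d) ?c) = fscale (of_nat (k * (d - k + 1))) ?c"
  proof (cases "k = 0")
    case False
    with k have "lie (raising d) ?c = fscale (- of_nat (d - k + 1)) (coord (Coeff (k - 1)))"
      by (subst lie_raising_coord) auto
    moreover have "k - 1 < d" "k - 1 + 1 = k" using False k by simp_all
    ultimately show ?thesis
      by (simp only: if_True lie_lowering_coord lie_scale [OF polynomial.coord] funs.scale_scale
          of_nat_mult minus_mult_minus mult.commute)
  qed (simp add: lie_raising_coord)
  moreover obtain n where "d = k + n" using k le_Suc_ex by blast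
  then have "of_nat ((k + 1) * (d - k)) - of_nat (k * (d - k + 1)) = (of_int (int d - 2 * int k) :: complex)"
    by (simp add: algebra_simps)
  ultimately show "bracket d ?c = fscale (of_int (int d - 2 * int k)) ?c"
    by (simp only: bracket_def funs.scale_left_diff_distrib [symmetric])
qed (auto simp: bracket_def lie_raising_coord lie_lowering_coord fscale_apply fun_eq_iff fun_apply)

lemma polynomial_lie:
  "polynomial F \<Longrightarrow> (\<And>v. polynomial (lie N (coord v))) \<Longrightarrow> polynomial (lie N F)"
proof (induction rule: polynomial.induct)
  case (const c)
  show ?case using polynomial.const [of 0] by (simp add: zero_fun_def)
next
  case (add F G)
  then have "polynomial (lie N F + lie N G)" by (intro polynomial.add) auto
  then show ?case using lie_add [OF add.hyps] by simp
next
  case (mult F G)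
  then have "polynomial (lie N F * G + F * lie N G)"
    by (intro polynomial.add polynomial.mult) auto
  then show ?case using lie_mult [OF mult.hyps] by simp
qed

lemma polynomial_raising: "polynomial F \<Longrightarrow> polynomial (lie (raising d) F)"
proof (erule polynomial_lie)
  fix v
  show "polynomial (lie (raising d) (coord v))"
    using polynomial.const [of 0]
    by (cases v) (auto simp: lie_raising_coord zero_fun_def intro: polynomial.coord polynomial_scale)
qed

lemma polynomial_lowering: "polynomial F \<Longrightarrow> polynomial (lie (lowering d) F)"
proof (erule polynomial_lie)
  fix v
  show "polynomial (lie (lowering d) (coord v))"
    using polynomial.const [of 0]
    by (cases v) (auto simp: lie_lowering_coord zero_fun_def intro: polynomial.coord polynomial_scale)
qed

lemma bracket_add: "polynomial F \<Longrightarrow> polynomial G \<Longrightarrow> bracket d (F + G) = bracket d F + bracket d G"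
  by (simp add: bracket_def lie_add polynomial_raising polynomial_lowering)

lemma bracket_scale: "polynomial F \<Longrightarrow> bracket d (fscale c F) = fscale c (bracket d F)"
  by (simp add: bracket_def lie_scale polynomial_raising polynomial_lowering funs.scale_right_diff_distrib)

lemma bracket_mult:
  "polynomial F \<Longrightarrow> polynomial G \<Longrightarrow> bracket d (F * G) = bracket d F * G + F * bracket d G"
  by (simp add: bracket_def lie_mult lie_add polynomial_raising polynomial_lowering polynomial.mult)
    (simp add: algebra_simps)

lemma bracket_graded: "graded d i j m F \<Longrightarrow> bracket d F = fscale (of_int m) F"
proof (induction rule: graded.induct)
  case zero
  show ?case by (simp add: bracket_def)
next
  case one
  show ?case by (simp add: bracket_def)
next
  case (Coeff i j m F k)
  then show ?case
    by (simp add: bracket_mult polynomial.coord graded_polynomial bracket_coord) (simp add: fscale_apply fun_eq_iff fun_apply algebra_simps)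
next
  case (VarX i j m F)
  then show ?case
    by (simp add: bracket_mult polynomial.coord graded_polynomial bracket_coord) (simp add: fscale_apply fun_eq_iff fun_apply algebra_simps)
next
  case (VarY i j m F)
  then show ?case
    by (simp add: bracket_mult polynomial.coord graded_polynomial bracket_coord) (simp add: fscale_apply fun_eq_iff fun_apply algebra_simps)
next
  case (add i j m F G)
  then show ?case by (simp add: bracket_add graded_polynomial funs.scale_right_distrib)
next
  case (scale i j m F c)
  then show ?case by (simp add: bracket_scale graded_polynomial mult.commute)
qed

lemma graded_weight_bound:
  "graded d i j m F \<Longrightarrow> F = 0 \<or> \<bar>m\<bar> \<le> int (d * i + j)"
  by (induction rule: graded.induct) (auto simp: algebra_simps abs_le_iff)

lemma sl2_module_graded:
  "sl2_module fscale (\<lambda>m. {F. graded d i j m F}) (lie (raising d)) (lie (lowering d))"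
proof
  fix m
  show "funs.subspace {F. graded d i j m F}"
    by (auto simp: funs.subspace_def intro: graded.intros)
next
  fix F m
  assume "F \<in> {F. graded d i j m F}"
  then have F: "graded d i j m F" by simp
  have "graded d i j (m + 2 * int r) ((lie (raising d) ^^ r) F)" for r
    by (induction r) (use F graded_raising in \<open>fastforce simp: algebra_simps\<close>)+
  \<comment> \<open>So many steps of size 2 carry the weight from \<open>m\<close> past the bound
    \<open>d * i + j\<close>, even when \<open>m\<close> starts at the far end.\<close>
  from graded_weight_bound [OF this [of "d * i + j + 1 + nat \<bar>m\<bar>"]]
  show "\<exists>r. (lie (raising d) ^^ r) F = 0" by fastforce
  have "graded d i j (m - 2 * int r) ((lie (lowering d) ^^ r) F)" for r
    by (induction r) (use F graded_lowering in \<open>fastforce simp: algebra_simps\<close>)+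
  from graded_weight_bound [OF this [of "d * i + j + 1 + nat \<bar>m\<bar>"]]
  show "\<exists>r. (lie (lowering d) ^^ r) F = 0" by fastforce
  show "lie (raising d) (lie (lowering d) F) = lie (lowering d) (lie (raising d) F) + fscale (of_int m) F"
    using bracket_graded [OF F] by (simp add: bracket_def algebra_simps)
qed (auto simp: lie_add lie_scale graded_polynomial intro: graded_raising graded_lowering)

section \<open>Invariance under the group\<close>

text \<open>The binomial expansion of the form at \<open>(u - s v, v)\<close>. Entries beyond
  \<open>d\<close> stay fixed, in agreement with the zero components of
  \<open>raising\<close>.\<close>

definition raise_coeff :: "nat \<Rightarrow> complex \<Rightarrow> (nat \<Rightarrow> complex) \<Rightarrow> nat \<Rightarrow> complex" where
  "raise_coeff d s a k =
     (if k \<le> d then \<Sum>l\<le>k. a l * of_nat ((d - l) choose (k - l)) * (- s) ^ (k - l) else a k)"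

definition reverse_coeff :: "nat \<Rightarrow> (nat \<Rightarrow> complex) \<Rightarrow> nat \<Rightarrow> complex" where
  "reverse_coeff d a k = (if k \<le> d then a (d - k) else a k)"

text \<open>Reversing coefficients exchanges the two variables, so the lower flow is a conjugate of
  the upper one and inherits its formulas.\<close>

definition lower_coeff :: "nat \<Rightarrow> complex \<Rightarrow> (nat \<Rightarrow> complex) \<Rightarrow> nat \<Rightarrow> complex" where
  "lower_coeff d s a = reverse_coeff d (raise_coeff d s (reverse_coeff d a))"

lemma bform_raise: "bform d (raise_coeff d s a) u v = bform d a (u - s * v) v"
proof -
  have "bform d (raise_coeff d s a) u v
      = (\<Sum>k\<le>d. \<Sum>l\<le>k. a l * of_nat ((d - l) choose (k - l)) * (- s) ^ (k - l) * u ^ (d - k) * v ^ k)"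
    by (simp add: bform_def raise_coeff_def sum_distrib_right)
  also have "\<dots> = (\<Sum>l\<le>d. \<Sum>j\<le>d - l. a l * of_nat ((d - l) choose j) * (- s) ^ j * u ^ (d - l - j) * v ^ (l + j))"
    unfolding sum.Sigma [OF finite_atMost ballI [OF finite_atMost]]
    by (rule sum.reindex_bij_witness [of _ "\<lambda>(l, j). (l + j, l)" "\<lambda>(k, l). (l, k - l)"]) auto
  also have "\<dots> = (\<Sum>l\<le>d. a l * (u - s * v) ^ (d - l) * v ^ l)"
  proof (intro sum.cong refl)
    fix l
    have "(u - s * v) ^ (d - l) = (\<Sum>j\<le>d - l. of_nat ((d - l) choose j) * (- s * v) ^ j * u ^ (d - l - j))"
      using binomial_ring [of "- s * v" u "d - l"] by simp
    then show "(\<Sum>j\<le>d - l. a l * of_nat ((d - l) choose j) * (- s) ^ j * u ^ (d - l - j) * v ^ (l + j))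
        = a l * (u - s * v) ^ (d - l) * v ^ l"
      by (simp only: sum_distrib_left sum_distrib_right power_mult_distrib power_add mult_ac)
  qed
  finally show ?thesis by (simp add: bform_def)
qed

lemma bform_reverse: "bform d (reverse_coeff d a) u v = bform d a v u"
  unfolding bform_def reverse_coeff_def
  by (rule sum.reindex_bij_witness [of _ "\<lambda>k. d - k" "\<lambda>k. d - k"]) auto

lemma bform_lower: "bform d (lower_coeff d s a) u v = bform d a u (v - s * u)"
  by (simp add: lower_coeff_def bform_reverse bform_raise)

lemma raise_coeff_0 [simp]: "raise_coeff d 0 a = a"
proof
  fix k
  have "(\<Sum>l\<le>k. a l * of_nat ((d - l) choose (k - l)) * (- 0) ^ (k - l))
      = (\<Sum>l\<le>k. if l = k then a l else 0)"
    by (intro sum.cong) (auto simp: power_0_left)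
  then show "raise_coeff d 0 a k = a k" by (simp add: raise_coeff_def)
qed

lemma reverse_reverse [simp]: "reverse_coeff d (reverse_coeff d a) = a"
  by (auto simp: reverse_coeff_def)

lemma lower_coeff_0 [simp]: "lower_coeff d 0 a = a"
  by (simp add: lower_coeff_def)

lemma DERIV_raise_coeff:
  "((\<lambda>s. raise_coeff d s a k) has_field_derivative
     (if k = 0 \<or> k > d then 0 else - of_nat (d - k + 1) * raise_coeff d s a (k - 1))) (at s)"
proof (cases "k = 0 \<or> k > d")
  case True
  then show ?thesis by (auto simp: raise_coeff_def)
next
  case False
  then obtain m where k: "k = Suc m" "m < d" by (cases k) auto
  let ?D = "\<Sum>l\<le>k. a l * of_nat ((d - l) choose (k - l)) * (of_nat (k - l) * (- s) ^ (k - l - 1) * (- 1))"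
  have "((\<lambda>s. \<Sum>l\<le>k. a l * of_nat ((d - l) choose (k - l)) * (- s) ^ (k - l)) has_field_derivative ?D) (at s)"
    by (auto intro!: derivative_eq_intros sum.cong)
  also have "?D = (\<Sum>l\<le>m. - of_nat (d - k + 1) * (a l * of_nat ((d - l) choose (m - l)) * (- s) ^ (m - l)))"
    unfolding k(1) sum.atMost_Suc
  proof (simp only: diff_self_eq_0 of_nat_0 mult_zero_left mult_zero_right add_0_right, intro sum.cong refl)
    fix l assume "l \<in> {..m}"
    then have l: "Suc m - l = Suc (m - l)" "d - Suc m + 1 = (d - l) - (m - l)" using k by auto
    \<comment> \<open>Absorption yields the factor \<open>(d - l) - (m - l) = d - m\<close>, which
      is independent of \<open>l\<close> and can leave the sum.\<close>
    have "Suc (m - l) * ((d - l) choose Suc (m - l)) = ((d - l) - (m - l)) * ((d - l) choose (m - l))"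
      by (metis binomial_absorb_comp binomial_absorption)
    then have eq: "of_nat (Suc (m - l)) * of_nat ((d - l) choose Suc (m - l))
        = (of_nat ((d - l) - (m - l)) * of_nat ((d - l) choose (m - l)) :: complex)"
      by (simp only: of_nat_mult [symmetric])
    show "a l * of_nat ((d - l) choose (Suc m - l)) * (of_nat (Suc m - l) * (- s) ^ (Suc m - l - 1) * (- 1))
        = - of_nat (d - Suc m + 1) * (a l * of_nat ((d - l) choose (m - l)) * (- s) ^ (m - l))"
      unfolding l using eq by (simp del: of_nat_Suc of_nat_diff) (metis mult.assoc mult.commute)
  qed
  also have "\<dots> = - of_nat (d - k + 1) * raise_coeff d s a (k - 1)"
    using k by (simp add: raise_coeff_def sum_distrib_left)
  finally show ?thesis using False k by (simp add: raise_coeff_def)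
qed

lemma DERIV_lower_coeff:
  "((\<lambda>s. lower_coeff d s a k) has_field_derivative
     (if k < d then - of_nat (k + 1) * lower_coeff d s a (k + 1) else 0)) (at s)"
proof (cases "k \<le> d")
  case True
  then show ?thesis
    using DERIV_raise_coeff [of d "reverse_coeff d a" "d - k" s]
    by (auto simp: lower_coeff_def reverse_coeff_def [of d "raise_coeff d _ _"] Suc_diff_Suc split: if_splits)
next
  case False
  then show ?thesis
    by (simp add: lower_coeff_def reverse_coeff_def raise_coeff_def)
qed

definition raise_point :: "nat \<Rightarrow> complex \<Rightarrow> point \<Rightarrow> point" where
  "raise_point d s = (\<lambda>(a, x, y). (raise_coeff d s a, x + s * y, y))"

definition lower_point :: "nat \<Rightarrow> complex \<Rightarrow> point \<Rightarrow> point" where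
  "lower_point d s = (\<lambda>(a, x, y). (lower_coeff d s a, x, y + s * x))"

lemma raise_point_0 [simp]: "raise_point d 0 w = w"
  by (cases w) (simp add: raise_point_def)

lemma lower_point_0 [simp]: "lower_point d 0 w = w"
  by (cases w) (simp add: lower_point_def)

lemma velocity_raise: "has_velocity (\<lambda>s. raise_point d s w) (raising d (raise_point d s w)) s"
  unfolding has_velocity_def
proof
  fix v
  obtain a x y where w: "w = (a, x, y)" by (cases w) auto
  show "((\<lambda>s. coord v (raise_point d s w)) has_field_derivative coord v (raising d (raise_point d s w))) (at s)"
  proof (cases v)
    case (Coeff k)
    then show ?thesis using DERIV_raise_coeff [of d a k s] by (simp add: w raise_point_def raising_def)
  qed (auto simp: w raise_point_def raising_def intro!: derivative_eq_intros)
qed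

lemma velocity_lower: "has_velocity (\<lambda>s. lower_point d s w) (lowering d (lower_point d s w)) s"
  unfolding has_velocity_def
proof
  fix v
  obtain a x y where w: "w = (a, x, y)" by (cases w) auto
  show "((\<lambda>s. coord v (lower_point d s w)) has_field_derivative coord v (lowering d (lower_point d s w))) (at s)"
  proof (cases v)
    case (Coeff k)
    then show ?thesis using DERIV_lower_coeff [of d a k s] by (simp add: w lower_point_def lowering_def)
  qed (auto simp: w lower_point_def lowering_def intro!: derivative_eq_intros)
qed

text \<open>Along each orbit the derivative of \<open>F\<close> is \<open>lie N F\<close> at the
  current point. Its value at time 0 gives one direction; its vanishing at all times makes
  \<open>F\<close> constant on the orbit.\<close>

lemma constant_along_flow_iff:
  assumes F: "polynomial F"
    and flow: "\<And>w s. has_velocity (\<lambda>s. c s w) (N (c s w)) s" "\<And>w. c 0 w = w"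
  shows "(\<forall>s w. F (c s w) = F w) \<longleftrightarrow> lie N F = 0"
proof -
  have deriv: "((\<lambda>s. F (c s w)) has_field_derivative lie N F (c s w)) (at s)" for s w
    by (rule polynomial_derivative [where c = "\<lambda>s. c s w" and N = N]) (fact F, fact flow(1))
  show ?thesis
  proof
    assume const: "\<forall>s w. F (c s w) = F w"
    show "lie N F = 0"
    proof
      fix w
      have "((\<lambda>s. F w) has_field_derivative lie N F w) (at 0)"
        using deriv [of w 0] by (simp only: const flow(2))
      then show "lie N F w = 0 w"
        using DERIV_unique [OF _ DERIV_const] by (simp only: zero_fun_apply)
    qed
  next
    assume zero: "lie N F = 0"
    show "\<forall>s w. F (c s w) = F w"
    proof (intro allI)
      fix s w
      have "((\<lambda>s. F (c s w)) has_field_derivative 0) (at s)" for s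
        using deriv [of w s] by (simp only: zero zero_fun_apply)
      then obtain e where "\<And>s. F (c s w) = e"
        using has_field_derivative_zero_constant [of UNIV "\<lambda>s. F (c s w)"] by auto
      then have "F (c s w) = F (c 0 w)" by simp
      then show "F (c s w) = F w" by (simp only: flow(2))
    qed
  qed
qed

lemma bform_coeff_unique:
  assumes "\<And>u v. bform d a u v = bform d b u v" "k \<le> d"
  shows "a k = b k"
proof -
  have "\<forall>v. (\<Sum>i\<le>d. a i * v ^ i) = (\<Sum>i\<le>d. b i * v ^ i)"
    using assms(1) [of 1] by (simp add: bform_def)
  then show ?thesis using assms(2) by (simp add: polyfun_eq_coeffs)
qed

text \<open>The unipotent matrices generate the group. The hypothesis \<open>cong\<close> is there
  because the transformed form determines the vector \<open>b\<close> only up to index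
  \<open>d\<close>.\<close>

lemma sl2_invariant_iff:
  assumes F: "polynomial F" and cong: "\<And>a b x y. (\<And>k. k \<le> d \<Longrightarrow> a k = b k) \<Longrightarrow> F (a, x, y) = F (b, x, y)"
  shows "sl2_invariant d F \<longleftrightarrow> lie (raising d) F = 0 \<and> lie (lowering d) F = 0"
proof
  assume inv: "sl2_invariant d F"
  have "F (raise_point d s w) = F w" for s w
  proof -
    obtain a x y where w: "w = (a, x, y)" by (cases w) auto
    show ?thesis
      using inv [unfolded sl2_invariant_def, rule_format, of 1 1 s 0 "raise_coeff d s a" a x y]
      by (simp add: w raise_point_def bform_raise)
  qed
  moreover have "F (lower_point d s w) = F w" for s w
  proof -
    obtain a x y where w: "w = (a, x, y)" by (cases w) auto
    show ?thesis
      using inv [unfolded sl2_invariant_def, rule_format, of 1 1 0 s "lower_coeff d s a" a x y]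
      by (simp add: w lower_point_def bform_lower add.commute)
  qed
  ultimately show "lie (raising d) F = 0 \<and> lie (lowering d) F = 0"
    using constant_along_flow_iff [where c = "raise_point d", OF F velocity_raise raise_point_0]
      constant_along_flow_iff [where c = "lower_point d", OF F velocity_lower lower_point_0]
    by simp
next
  assume zero: "lie (raising d) F = 0 \<and> lie (lowering d) F = 0"
  have R: "F (raise_point d s w) = F w" for s w
    using constant_along_flow_iff [where c = "raise_point d", OF F velocity_raise raise_point_0] zero
    by (simp only: simp_thms)
  have L: "F (lower_point d s w) = F w" for s w
    using constant_along_flow_iff [where c = "lower_point d", OF F velocity_lower lower_point_0] zero
    by (simp only: simp_thms)
  \<comment> \<open>A matrix with \<open>ga \<noteq> 0\<close> is the product of an upper, a lower and an upper unipotent matrix.\<close>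
  have main: "F (b, al * x + be * y, ga * x + de * y) = F (a, x, y)"
    if det: "al * de - be * ga = 1" and "ga \<noteq> 0"
      and b: "\<And>u v. bform d b u v = bform d a (de * u - be * v) (- ga * u + al * v)"
    for al be ga de a b x y
  proof -
    \<comment> \<open>In the product of the upper matrix of \<open>s\<close>, the lower one of
      \<open>ga\<close> and the upper one of \<open>t\<close>, the diagonal entries are
      \<open>1 + s ga\<close> and \<open>1 + t ga\<close>; the determinant then fixes
      \<open>be\<close>.\<close>
    define s t where "s = (al - 1) / ga" and "t = (de - 1) / ga"
    have al: "al = 1 + s * ga" and de: "de = 1 + t * ga" and be: "be = s + t + s * t * ga"
      using det \<open>ga \<noteq> 0\<close> by (simp_all add: s_def t_def field_simps)
    let ?b = "raise_coeff d s (lower_coeff d ga (raise_coeff d t a))"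
    have forms: "bform d b u v = bform d ?b u v" for u v
      by (simp only: b bform_raise bform_lower al de be)
        (rule arg_cong2 [where f = "bform d a"]; simp add: algebra_simps)
    have "F (b, al * x + be * y, ga * x + de * y) = F (?b, al * x + be * y, ga * x + de * y)"
      by (rule cong) (rule bform_coeff_unique [OF forms])
    also have "\<dots> = F (raise_point d s (lower_point d ga (raise_point d t (a, x, y))))"
      by (simp add: raise_point_def lower_point_def al be de algebra_simps)
    also have "\<dots> = F (a, x, y)" by (simp add: R L)
    finally show ?thesis .
  qed
  show "sl2_invariant d F"
    unfolding sl2_invariant_def
  proof (intro allI impI)
    fix al be ga de :: complex and a b :: "nat \<Rightarrow> complex" and x y
    assume det: "al * de - be * ga = 1"
      and b: "\<forall>u v. bform d b u v = bform d a (de * u - be * v) (- ga * u + al * v)"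
    show "F (b, al * x + be * y, ga * x + de * y) = F (a, x, y)"
    proof (cases "ga = 0")
      case False
      then show ?thesis using main det b by blast
    next
      case True
      \<comment> \<open>The matrix is multiplied on the right by the lower unipotent of parameter 1
        and the point moved by its inverse. The new lower left entry is \<open>de\<close>, nonzero
        since \<open>al * de = 1\<close>.\<close>
      let ?a = "lower_coeff d (- 1) a"
      have "F (b, (al + be) * x + be * (y - x), (ga + de) * x + de * (y - x)) = F (?a, x, y - x)"
      proof (rule main)
        show "(al + be) * de - be * (ga + de) = 1" using det by (simp add: algebra_simps)
        show "ga + de \<noteq> 0" using det True by auto
        show "bform d b u v = bform d ?a (de * u - be * v) (- (ga + de) * u + (al + be) * v)" for u v
          unfolding bform_lower b [rule_format]
          by (rule arg_cong2 [where f = "bform d a"]) (simp_all add: algebra_simps)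
      qed
      also have "F (?a, x, y - x) = F (lower_point d (- 1) (a, x, y))"
        by (simp add: lower_point_def)
      finally show ?thesis by (simp add: L algebra_simps)
    qed
  qed
qed

section \<open>Monomials and the dimension formula\<close>

lemma sum_fun_apply: "sum f A w = (\<Sum>x\<in>A. f x w)" for f :: "'a \<Rightarrow> 'b \<Rightarrow> complex"
  by (induction A rule: infinite_finite_induct) (simp_all add: fun_apply)

text \<open>Dedekind's argument for multiplicative functions. It applies to monomials, which are
  multiplicative for the coordinatewise product of points.\<close>

lemma characters_independent:
  fixes chi :: "'i \<Rightarrow> 'w \<Rightarrow> complex"
  assumes "finite I" "inj_on chi I"
    and "\<And>i u v. i \<in> I \<Longrightarrow> chi i (mul u v) = chi i u * chi i v" "\<And>i. i \<in> I \<Longrightarrow> chi i e = 1"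
    and "\<And>w. (\<Sum>i\<in>I. c i * chi i w) = 0"
  shows "\<forall>i\<in>I. c i = 0"
  using assms
proof (induction I arbitrary: c rule: finite_induct)
  case empty
  then show ?case by simp
next
  case (insert j I)
  have zero: "c j * chi j w + (\<Sum>i\<in>I. c i * chi i w) = 0" for w
    using insert.prems(4) [of w] insert.hyps by simp
  have I: "c i = 0" if "i \<in> I" for i
  proof (rule ccontr)
    assume "c i \<noteq> 0"
    have "chi i \<noteq> chi j"
      using inj_onD [OF insert.prems(1), of i j] insert.hyps \<open>i \<in> I\<close> by blast
    then obtain u where u: "chi i u \<noteq> chi j u" by blast
    \<comment> \<open>The relation translated by \<open>u\<close>, minus \<open>chi j u\<close>
      times the original one, loses its \<open>j\<close>-th term.\<close>
    have "(\<Sum>i\<in>I. (c i * (chi i u - chi j u)) * chi i w) = 0" for w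
    proof -
      have "(\<Sum>i\<in>I. (c i * (chi i u - chi j u)) * chi i w)
          = (\<Sum>i\<in>I. c i * chi i (mul u w)) - chi j u * (\<Sum>i\<in>I. c i * chi i w)"
        unfolding sum_distrib_left sum_subtractf [symmetric]
        by (intro sum.cong) (simp_all add: insert.prems(2) algebra_simps)
      also have "\<dots> = - c j * chi j (mul u w) + chi j u * (c j * chi j w)"
        using zero [of "mul u w"] zero [of w] by (simp add: add_eq_0_iff algebra_simps)
      also have "\<dots> = 0" by (simp add: insert.prems(2))
      finally show ?thesis .
    qed
    then have "\<forall>i\<in>I. c i * (chi i u - chi j u) = 0"
      using insert.prems by (intro insert.IH) (auto simp: inj_on_def)
    from this [rule_format, OF \<open>i \<in> I\<close>] \<open>c i \<noteq> 0\<close> u show False by simp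
  qed
  moreover have "c j = 0"
    using zero [of e] I by (simp add: insert.prems(3))
  ultimately show ?case by simp
qed

definition monomial :: "nat \<Rightarrow> (nat \<Rightarrow> nat) \<times> nat \<times> nat \<Rightarrow> point \<Rightarrow> complex" where
  "monomial d = (\<lambda>(e, p, q) (a, x, y). (\<Prod>k\<le>d. a k ^ e k) * x ^ p * y ^ q)"

definition bidegree_exponents :: "nat \<Rightarrow> nat \<Rightarrow> nat \<Rightarrow> ((nat \<Rightarrow> nat) \<times> nat \<times> nat) set" where
  "bidegree_exponents d i j = {(e, p, q). e \<in> exponents d i \<and> p + q = j}"

lemma finite_bidegree_exponents [simp]: "finite (bidegree_exponents d i j)"
  by (rule finite_subset [of _ "exponents d i \<times> {..j} \<times> {..j}"]) (auto simp: bidegree_exponents_def)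

lemma weight_exponents_eq: "weight_exponents d i j m = {v \<in> bidegree_exponents d i j. weight d v = m}"
  by (auto simp: weight_exponents_def bidegree_exponents_def)

lemma bimonomials_eq: "bimonomials d i j = monomial d ` bidegree_exponents d i j"
proof -
  have "bimonomials d i j = {monomial d (e, p, q) | e p q. (e, p, q) \<in> bidegree_exponents d i j}"
    unfolding bimonomials_def monomial_def bidegree_exponents_def exponents_def by simp
  also have "\<dots> = monomial d ` bidegree_exponents d i j"
    unfolding image_def by (simp add: split_paired_Ex Bex_def) (rule Collect_cong, blast)
  finally show ?thesis .
qed

lemma two_power_eq_iff: "(2 :: complex) ^ m = 2 ^ n \<longleftrightarrow> m = n"
proof -
  have "(2 :: complex) ^ m = 2 ^ n \<longleftrightarrow> of_nat (2 ^ m) = (of_nat (2 ^ n) :: complex)" by simp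
  then show ?thesis unfolding of_nat_eq_iff by simp
qed

text \<open>Each exponent is read off at the point with 2 in one coordinate and 1 in the
  others.\<close>

lemma inj_on_monomial: "inj_on (monomial d) (bidegree_exponents d i j)"
proof (rule inj_onI)
  fix v v'
  assume in_M: "v \<in> bidegree_exponents d i j" "v' \<in> bidegree_exponents d i j"
    and eq_v: "monomial d v = monomial d v'"
  obtain e p q e' p' q' where v: "v = (e, p, q)" "v' = (e', p', q')"
    by (cases v; cases v') auto
  note eq = eq_v [unfolded v]
  have "p = p'"
    using fun_cong [OF eq, of "(\<lambda>k. 1, 2, 1)"] by (simp add: monomial_def two_power_eq_iff)
  moreover have "q = q'"
    using fun_cong [OF eq, of "(\<lambda>k. 1, 1, 2)"] by (simp add: monomial_def two_power_eq_iff)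
  moreover have "e k = e' k" for k
  proof (cases "k \<le> d")
    case True
    have "(\<Prod>l\<le>d. (if l = k then 2 else 1) ^ f l) = (2 :: complex) ^ f k" for f :: "nat \<Rightarrow> nat"
      using True by (simp add: prod.remove [of _ k])
    then show ?thesis
      using fun_cong [OF eq, of "(\<lambda>l. if l = k then 2 else 1, 1, 1)"] by (simp add: monomial_def two_power_eq_iff)
  next
    case False
    then show ?thesis using in_M v by (simp add: bidegree_exponents_def exponents_def)
  qed
  ultimately show "v = v'" using v by auto
qed

lemma monomials_independent:
  assumes "(\<Sum>v\<in>bidegree_exponents d i j. fscale (c v) (monomial d v)) = 0"
    and "v \<in> bidegree_exponents d i j"
  shows "c v = 0"
proof -
  let ?mul = "\<lambda>(a, x, y) (b, x', y'). (\<lambda>k. a k * b k :: complex, x * x' :: complex, y * y' :: complex)"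
  have "\<forall>v\<in>bidegree_exponents d i j. c v = 0"
    using finite_bidegree_exponents inj_on_monomial
  proof (rule characters_independent [where chi = "monomial d" and mul = ?mul and e = "(\<lambda>k. 1, 1, 1)"])
    show "(\<Sum>v\<in>bidegree_exponents d i j. c v * monomial d v w) = 0" for w
      using fun_cong [OF assms(1), of w] by (simp add: sum_fun_apply fscale_apply fun_apply)
  qed (auto simp: monomial_def prod.distrib power_mult_distrib split: prod.splits)
  then show ?thesis using assms(2) by blast
qed

lemma independent_monomials:
  assumes "M \<subseteq> bidegree_exponents d i j"
  shows "funs.independent (monomial d ` M)"
proof -
  have "funs.independent (monomial d ` bidegree_exponents d i j)"
  proof (rule funs.independent_if_scalars_zero)
    fix f x
    assume "(\<Sum>x\<in>monomial d ` bidegree_exponents d i j. fscale (f x) x) = 0"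
      and "x \<in> monomial d ` bidegree_exponents d i j"
    then show "f x = 0"
      using monomials_independent [where c = "\<lambda>v. f (monomial d v)"]
      by (auto simp: sum.reindex [OF inj_on_monomial])
  qed simp
  then show ?thesis using assms funs.independent_mono by blast
qed

section \<open>Weight spaces as spans of monomials\<close>

lemma monomial_Suc_Coeff:
  assumes "k \<le> d"
  shows "monomial d (e(k := Suc (e k)), p, q) = coord (Coeff k) * monomial d (e, p, q)"
proof
  fix w :: point
  obtain a x y where w: "w = (a, x, y)" by (cases w) auto
  have "(\<Prod>l\<in>{..d} - {k}. a l ^ (e(k := Suc (e k))) l) = (\<Prod>l\<in>{..d} - {k}. a l ^ e l)"
    by (rule prod.cong) auto
  then have "(\<Prod>l\<le>d. a l ^ (e(k := Suc (e k))) l) = a k * (\<Prod>l\<le>d. a l ^ e l)"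
    using assms by (simp add: prod.remove [of "{..d}" k])
  then show "monomial d (e(k := Suc (e k)), p, q) w = (coord (Coeff k) * monomial d (e, p, q)) w"
    by (simp add: w monomial_def fun_apply)
qed

lemma monomial_Suc_VarX: "monomial d (e, Suc p, q) = coord VarX * monomial d (e, p, q)"
  by (auto simp: monomial_def fun_apply)

lemma monomial_Suc_VarY: "monomial d (e, p, Suc q) = coord VarY * monomial d (e, p, q)"
  by (auto simp: monomial_def fun_apply)

lemma sum_Suc_exponent:
  fixes d k :: nat
  assumes "k \<le> d"
  shows "(\<Sum>l\<le>d. (e(k := Suc (e k))) l) = Suc (\<Sum>l\<le>d. e l)"
proof -
  have "(\<Sum>l\<in>{..d} - {k}. (e(k := Suc (e k))) l) = (\<Sum>l\<in>{..d} - {k}. e l)"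
    by (rule sum.cong) auto
  then show ?thesis using assms by (subst (1 2) sum.remove [of "{..d}" k]) simp_all
qed

lemma weight_Suc_Coeff:
  assumes "k \<le> d"
  shows "weight d (e(k := Suc (e k)), p, q) = weight d (e, p, q) + int d - 2 * int k"
proof -
  have "(\<Sum>l\<in>{..d} - {k}. (int d - 2 * int l) * int ((e(k := Suc (e k))) l))
      = (\<Sum>l\<in>{..d} - {k}. (int d - 2 * int l) * int (e l))"
    by (rule sum.cong) auto
  then show ?thesis using assms
    by (simp add: weight_def sum.remove [of "{..d}" k] algebra_simps)
qed

lemma graded_monomial:
  "e \<in> exponents d i \<Longrightarrow> graded d i (p + q) (weight d (e, p, q)) (monomial d (e, p, q))"
proof (induction q)
  case 0
  then show ?case
  proof (induction p)
    case 0
    then show ?case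
    proof (induction i arbitrary: e)
      case 0
      then have e: "e = (\<lambda>k. 0)" by (simp add: exponents_0_right)
      have "monomial d (e, 0, 0) = 1"
        by (auto simp: e monomial_def fun_apply)
      moreover have "weight d (e, 0, 0) = 0" by (simp add: e weight_def)
      ultimately show ?case using graded.one by simp
    next
      case (Suc i)
      then have "(\<Sum>k\<le>d. e k) \<noteq> 0" by (simp add: exponents_def)
      then obtain k where k: "k \<le> d" "e k \<noteq> 0" by auto
      define e' where "e' = e(k := e k - 1)"
      have e: "e = e'(k := Suc (e' k))" using k by (auto simp: e'_def)
      have "e' \<in> exponents d i"
        using Suc.prems sum_Suc_exponent [OF k(1), of e'] k(1) unfolding e [symmetric]
        by (auto simp: exponents_def e'_def)
      from graded.Coeff [OF Suc.IH [OF this] k(1)]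
      show ?case
        unfolding monomial_Suc_Coeff [OF k(1), symmetric] weight_Suc_Coeff [OF k(1), symmetric]
          e [symmetric] .
    qed
  next
    case (Suc p)
    have "weight d (e, Suc p, 0) = weight d (e, p, 0) - 1" by (simp add: weight_def)
    then show ?case
      using graded.VarX [OF Suc.IH] Suc.prems by (simp add: monomial_Suc_VarX)
  qed
next
  case (Suc q)
  have "weight d (e, p, Suc q) = weight d (e, p, q) + 1" by (simp add: weight_def)
  then show ?case
    using graded.VarY [OF Suc.IH] Suc.prems by (simp add: monomial_Suc_VarY)
qed

lemma span_mult_subset:
  assumes "F \<in> funs.span A" "\<And>G. G \<in> A \<Longrightarrow> H * G \<in> B"
  shows "H * F \<in> funs.span B"
  using assms(1)
proof (induction rule: funs.span_induct_alt)
  case base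
  show ?case using funs.span_zero by (simp add: zero_fun_def times_fun_def)
next
  case (step c G F)
  have "H * (fscale c G + F) = fscale c (H * G) + H * F"
    by (simp add: fun_eq_iff fun_apply fscale_apply algebra_simps)
  then show ?case
    using step assms(2) funs.span_add funs.span_scale funs.span_base by metis
qed

lemma graded_iff_span:
  "graded d i j m F \<longleftrightarrow> F \<in> funs.span (monomial d ` weight_exponents d i j m)"
proof
  show "F \<in> funs.span (monomial d ` weight_exponents d i j m)" if "graded d i j m F"
    using that
  proof (induction rule: graded.induct)
    case one
    have "monomial d (\<lambda>k. 0, 0, 0) = 1" by (auto simp: monomial_def fun_apply)
    moreover have "(\<lambda>k. 0, 0, 0) \<in> weight_exponents d 0 0 0"
      by (simp add: weight_exponents_def exponents_0_right weight_def)
    ultimately show ?case by (metis funs.span_base imageI)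
  next
    case (Coeff i j m F k)
    show ?case
    proof (rule span_mult_subset [OF Coeff.IH], clarify)
      fix e p q assume v: "(e, p, q) \<in> weight_exponents d i j m"
      then have "(e(k := Suc (e k)), p, q) \<in> weight_exponents d (Suc i) j (m + int d - 2 * int k)"
        using Coeff.hyps sum_Suc_exponent [of k d e] weight_Suc_Coeff [of k d e p q]
        by (auto simp: weight_exponents_def exponents_def)
      then show "coord (Coeff k) * monomial d (e, p, q)
          \<in> monomial d ` weight_exponents d (Suc i) j (m + int d - 2 * int k)"
        using monomial_Suc_Coeff [OF Coeff.hyps(2), of e p q] by (metis imageI)
    qed
  next
    case (VarX i j m F)
    show ?case
    proof (rule span_mult_subset [OF VarX.IH], clarify)
      fix e p q assume v: "(e, p, q) \<in> weight_exponents d i j m"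
      then have "(e, Suc p, q) \<in> weight_exponents d i (Suc j) (m - 1)"
        by (auto simp: weight_exponents_def weight_def)
      then show "coord VarX * monomial d (e, p, q) \<in> monomial d ` weight_exponents d i (Suc j) (m - 1)"
        by (metis imageI monomial_Suc_VarX)
    qed
  next
    case (VarY i j m F)
    show ?case
    proof (rule span_mult_subset [OF VarY.IH], clarify)
      fix e p q assume v: "(e, p, q) \<in> weight_exponents d i j m"
      then have "(e, p, Suc q) \<in> weight_exponents d i (Suc j) (m + 1)"
        by (auto simp: weight_exponents_def weight_def)
      then show "coord VarY * monomial d (e, p, q) \<in> monomial d ` weight_exponents d i (Suc j) (m + 1)"
        by (metis imageI monomial_Suc_VarY)
    qed
  qed (rule funs.span_zero funs.span_add funs.span_scale; assumption)+
  show "graded d i j m F" if "F \<in> funs.span (monomial d ` weight_exponents d i j m)"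
    using that
  proof (induction rule: funs.span_induct_alt)
    case base
    show ?case by (rule graded.zero)
  next
    case (step c G F)
    then have "graded d i j m G"
      using graded_monomial by (auto simp: weight_exponents_def)
    then show ?case using step graded.add graded.scale by blast
  qed
qed

section \<open>The invariants of a given bidegree and their dimension\<close>

lemma bihom_eq: "bihom d i j = funs.span (monomial d ` bidegree_exponents d i j)"
  by (simp add: bihom_def bimonomials_eq)

lemma monomial_polynomial: "v \<in> bidegree_exponents d i j \<Longrightarrow> polynomial (monomial d v)"
  using graded_polynomial [OF graded_monomial] by (auto simp: bidegree_exponents_def)

lemma bihom_polynomial:
  assumes "F \<in> bihom d i j"
  shows "polynomial F"
  using assms unfolding bihom_eq
proof (induction rule: funs.span_induct_alt)
  case base
  show ?case using graded_polynomial [OF graded.zero] .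
next
  case (step c G F)
  then show ?case using monomial_polynomial by (blast intro: polynomial.add polynomial_scale)
qed

lemma bihom_cong:
  assumes "F \<in> bihom d i j" and eq: "\<And>k. k \<le> d \<Longrightarrow> a k = b k"
  shows "F (a, x, y) = F (b, x, y)"
  using assms(1) unfolding bihom_eq
proof (induction rule: funs.span_induct_alt)
  case (step c G F)
  then show ?case using eq by (auto simp: monomial_def fun_apply fscale_apply)
qed (simp add: fun_apply)

text \<open>The bracket acts on each monomial by its weight, so a form annihilated by both fields has
  only monomials of weight 0.\<close>

lemma annihilated_graded_0:
  assumes "F \<in> bihom d i j" "lie (raising d) F = 0" "lie (lowering d) F = 0"
  shows "graded d i j 0 F"
proof -
  let ?M = "bidegree_exponents d i j"
  obtain u where "F = (\<Sum>b\<in>monomial d ` ?M. fscale (u b) b)"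
    using assms(1) unfolding bihom_eq by (subst (asm) funs.span_finite) auto
  then have F: "F = (\<Sum>v\<in>?M. fscale (u (monomial d v)) (monomial d v))"
    by (simp add: sum.reindex [OF inj_on_monomial])
  \<comment> \<open>Polynomiality is carried through the induction because \<open>bracket\<close> is
    known to be additive on polynomials only.\<close>
  have "polynomial (\<Sum>v\<in>T. fscale (c v) (monomial d v)) \<and>
      bracket d (\<Sum>v\<in>T. fscale (c v) (monomial d v))
        = (\<Sum>v\<in>T. fscale (c v * of_int (weight d v)) (monomial d v))"
    if "finite T" "T \<subseteq> ?M" for T and c :: "_ \<Rightarrow> complex"
    using that
  proof (induction T rule: finite_induct)
    case empty
    then show ?case using graded_polynomial [OF graded.zero] by (simp add: bracket_def)
  next
    case (insert v T)
    have v: "graded d i j (weight d v) (monomial d v)"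
      using insert.prems graded_monomial by (auto simp: bidegree_exponents_def)
    have "bracket d (fscale (c v) (monomial d v)) = fscale (c v * of_int (weight d v)) (monomial d v)"
      by (simp add: bracket_scale graded_polynomial [OF v] bracket_graded [OF v])
    then show ?case
      using insert by (simp add: bracket_add polynomial.add polynomial_scale graded_polynomial [OF v])
  qed
  from this [OF finite_bidegree_exponents subset_refl, of "\<lambda>v. u (monomial d v)"]
  have "(\<Sum>v\<in>?M. fscale (u (monomial d v) * of_int (weight d v)) (monomial d v)) = 0"
    using assms(2,3) F by (simp add: bracket_def)
  then have zero: "u (monomial d v) * of_int (weight d v) = 0" if "v \<in> ?M" for v
    using monomials_independent [where c = "\<lambda>v. u (monomial d v) * of_int (weight d v)"] that by blast
  show ?thesis
    unfolding graded_iff_span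
    by (subst F, intro funs.span_sum)
      (use zero in \<open>fastforce simp: weight_exponents_eq intro: funs.span_scale funs.span_base funs.span_zero\<close>)
qed

lemma dim_graded: "funs.dim {F. graded d i j m F} = card (weight_exponents d i j m)"
proof -
  have sub: "weight_exponents d i j m \<subseteq> bidegree_exponents d i j"
    by (auto simp: weight_exponents_eq)
  have "{F. graded d i j m F} = funs.span (monomial d ` weight_exponents d i j m)"
    using graded_iff_span by blast
  then have "funs.dim {F. graded d i j m F} = card (monomial d ` weight_exponents d i j m)"
    using funs.dim_span_eq_card_independent [OF independent_monomials [OF sub]] by simp
  also have "\<dots> = card (weight_exponents d i j m)"
    by (rule card_image [OF inj_on_subset [OF inj_on_monomial sub]])
  finally show ?thesis .
qed

lemma invariants_eq:
  "{F \<in> bihom d i j. sl2_invariant d F}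
     = {F \<in> {F. graded d i j 0 F}. lie (raising d) F = 0 \<and> lie (lowering d) F = 0}"
proof -
  have "graded d i j 0 F \<Longrightarrow> F \<in> bihom d i j" for F
    unfolding graded_iff_span bihom_eq
    using funs.span_mono [of "monomial d ` weight_exponents d i j 0" "monomial d ` bidegree_exponents d i j"]
    by (auto simp: weight_exponents_eq)
  moreover have "sl2_invariant d F \<longleftrightarrow> lie (raising d) F = 0 \<and> lie (lowering d) F = 0" if "F \<in> bihom d i j" for F
    using sl2_invariant_iff [OF bihom_polynomial [OF that]] bihom_cong [OF that] by blast
  ultimately show ?thesis using annihilated_graded_0 by blast
qed

lemma covdim_plus_card:
  "covdim d i j + card (weight_exponents d i j 2) = card (weight_exponents d i j 0)"
proof -
  have "{F. graded d i j 0 F} \<subseteq> funs.span (monomial d ` weight_exponents d i j 0)"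
    using graded_iff_span by blast
  then have "funs.dim {F \<in> {F. graded d i j 0 F}. lie (raising d) F = 0 \<and> lie (lowering d) F = 0}
      + funs.dim {F. graded d i j 2 F} = funs.dim {F. graded d i j 0 F}"
    by (intro sl2_module.dim_invariants [OF sl2_module_graded]) simp_all
  then show ?thesis
    by (simp only: covdim_def invariants_eq dim_graded)
qed

text \<open>Both monomial counts cancel between \<open>covdim_plus_card\<close> and
  \<open>card_weight_exponents\<close>. The additive form avoids truncated subtraction until the
  values are complex.\<close>

lemma of_nat_covdim:
  "of_nat (covdim d i j)
    = (if j \<le> d * i then fps_nth ((1 - fps_X ^ 2) * altsum d (Suc i)) (d * i - j) else (0 :: complex))"
proof -
  have "covdim d i j + (if j + 2 \<le> d * i then level_count d i (d * i - j - 2) else 0)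
      = (if j \<le> d * i then level_count d i (d * i - j) else 0)"
    using covdim_plus_card [of d i j] card_weight_exponents [of d i j] by linarith
  then have "of_nat (covdim d i j) + of_nat (if j + 2 \<le> d * i then level_count d i (d * i - j - 2) else 0)
      = (of_nat (if j \<le> d * i then level_count d i (d * i - j) else 0) :: complex)"
    by (simp only: of_nat_add [symmetric])
  then show ?thesis
    unfolding level_count_diff_nth [symmetric] by (auto simp: algebra_simps split: if_splits)
qed

theorem theorem3:
  fixes d :: nat
  assumes "d \<ge> 1"
  shows "poincare d =
    (\<Sum>k | 2 * k < d.
       psi (d - 2 * k)
         ((fps_const ((-1) ^ k) * fps_X ^ (k * (k + 1)) * (1 - fps_X ^ 2)) /
          (qpoch (fps_X ^ 2) (fps_X ^ 2) k * qpoch (fps_X ^ 2) (fps_X ^ 2) (d - k)))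
       * inverse (1 - fps_X * fps_const (fps_X ^ (d - 2 * k))))"
proof (intro fps_ext)
  fix i j
  have "fps_nth (fps_nth (\<Sum>k | 2 * k < d. psi (d - 2 * k) (summand d k)
        * inverse (1 - fps_X * fps_const (fps_X ^ (d - 2 * k)))) i) j
      = (\<Sum>k | 2 * k < d. if j \<le> (d - 2 * k) * i then fps_nth (summand d k) ((d - 2 * k) * i - j) else 0)"
    by (simp add: fps_sum_nth psi_mult_geometric_nth)
  also have "\<dots> = of_nat (covdim d i j)"
  proof (cases "j \<le> d * i")
    case True
    then show ?thesis using altsum_nth_eq_sum [OF assms True] of_nat_covdim [of d i j] by simp
  next
    case False
    then have "\<not> j \<le> (d - 2 * k) * i" for k
      by (meson diff_le_self le_trans mult_le_mono1)
    then show ?thesis using False of_nat_covdim [of d i j] by simp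
  qed
  finally show "fps_nth (fps_nth (poincare d) i) j = fps_nth (fps_nth (\<Sum>k | 2 * k < d.
       psi (d - 2 * k)
         ((fps_const ((-1) ^ k) * fps_X ^ (k * (k + 1)) * (1 - fps_X ^ 2)) /
          (qpoch (fps_X ^ 2) (fps_X ^ 2) k * qpoch (fps_X ^ 2) (fps_X ^ 2) (d - k)))
       * inverse (1 - fps_X * fps_const (fps_X ^ (d - 2 * k)))) i) j"
    by (simp add: poincare_def summand_def)
qed

end
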